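(* Let $d\in\mathbb N$, let $\Omega\subset\mathbb R^d$ be a bounded domain, let $\omega\in\mathbb R$, $p\in\mathbb N$ and $T:=2\pi p/\omega>0$. Let $\lambda>0$ and let $I\colon[0,T]\times\Omega\to\mathbb R$ be of class $C^1$. Let $\varepsilon,\delta>0$ and let $u\colon[0,T]\times\Omega\to\mathbb R^d$ of class $C^1$ be fixed. Consider flow velocities of the form $v(t,x)=\operatorname{Re}\big(a(x)\,\mathrm e^{\mathrm i\omega t}\big)$ of class $C^2$. Then the amplitude $a\colon\Omega\to\mathbb C^d$ of the minimizer $v$, among such velocities, of $$E_{u,\varepsilon,\delta}(v)=\int_\Omega\int_0^T\Big(q_\varepsilon\big(G_v(t,x),G_u(t,x)\big)+\lambda\,q_\delta\big(\|\nabla v(t,x)\|,\|\nabla u(t,x)\|\big)\Big)\,\mathrm dt\,\mathrm dx$$ satisfies $$\mathcal F[w_{\mathcal D}\nabla I\,\nabla I^{\mathrm T}](0,x)\,a(x)+\mathcal F[w_{\mathcal D}\nabla I\,\nabla I^{\mathrm T}](2\omega,x)\,\overline{a(x)}+2\,\mathcal F[w_{\mathcal D}\,\partial_tI\,\nabla I](\omega,x)$$ $$=\lambda\sum_{j=1}^d\partial_{x_j}\Big(\mathcal F[w_{\mathcal R}](0,x)\,\partial_{x_j}a(x)+\mathcal F[w_{\mathcal R}](2\omega,x)\,\overline{\partial_{x_j}a(x)}\Big)$$ for all $x\in\Omega$, where $w_{\mathcal D},w_{\mathcal R}\colon[0,T]\times\Omega\to\mathbb R$ are defined by $$w_{\mathcal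 D}(t,x):=\frac1{\max\{\varepsilon,|G_u(t,x)|\}},\qquad w_{\mathcal R}(t,x):=\frac1{\max\{\delta,\|\nabla u(t,x)\|\}}.$$
   Context: For a velocity field $w\colon[0,T]\times\Omega\to\mathbb R^d$, $G_w(t,x):=\nabla I(t,x)^{\mathrm T}w(t,x)+\partial_tI(t,x)$. For $\varepsilon>0$ and $x,z\in\mathbb R$, $q_\varepsilon(x,z):=\frac{|x|^2}{2\max\{\varepsilon,|z|\}}+\frac12\max\{\varepsilon,|z|\}$. $\nabla$ denotes the gradient (for vector-valued functions, the Jacobian) with respect to the spatial variable $x\in\mathbb R^d$ only, and $\nabla I$ is a column vector. $\|\cdot\|$ is the Frobenius norm, $\|\nabla v\|^2=\sum_{j,k=1}^d|\partial_{x_j}v_k|^2$. $\overline{a}$ is the componentwise complex conjugate. $\mathcal F$ is the Fourier transform in the time variable with $x$ fixed, applied entrywise to vector- or matrix-valued functions: for $f$ defined on $[0,T]\times\Omega$, $\mathcal F[f](\nu,x)=\int_0^Tf(t,x)\,\mathrm e^{-\mathrm i t\nu}\,\mathrm dt$ for $\nu\in\mathbb R$.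
   Formalization: E(v) is assumed finite (else every v could be a minimizer); as u is only C¹, the right-hand side may not exist classically, so the equation is proved in the sense of distributions on Ω and pointwise at each x where the bracketed terms under ∂_{x_j} are differentiable. *)

theory Defs
  imports "HOL-Analysis.Analysis"
begin

text \<open>
  Classes \<open>C\<^sup>1\<close> and \<open>C\<^sup>2\<close>. Derivatives are taken within \<open>S\<close>, so that for \<open>S = {0..T} \<times> \<Omega>\<close> with
  \<open>\<Omega>\<close> open they are one-sided in time at \<open>t = 0\<close> and \<open>t = T\<close>. For \<open>T > 0\<close> such derivatives are
  unique.
\<close>

definition C1_on :: "'a::real_normed_vector set \<Rightarrow> ('a \<Rightarrow> 'b::real_normed_vector) \<Rightarrow> bool" where
  "C1_on S f \<longleftrightarrow>
    (\<exists>f' :: 'a \<Rightarrow> 'a \<Rightarrow>\<^sub>L 'b.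
       (\<forall>z\<in>S. (f has_derivative blinfun_apply (f' z)) (at z within S)) \<and> continuous_on S f')"

definition C2_on :: "'a::real_normed_vector set \<Rightarrow> ('a \<Rightarrow> 'b::real_normed_vector) \<Rightarrow> bool" where
  "C2_on S f \<longleftrightarrow>
    (\<exists>f' :: 'a \<Rightarrow> 'a \<Rightarrow>\<^sub>L 'b.
       (\<forall>z\<in>S. (f has_derivative blinfun_apply (f' z)) (at z within S)) \<and> C1_on S f')"

definition partial_deriv :: "'n::finite \<Rightarrow> (real^'n \<Rightarrow> 'b::real_normed_vector) \<Rightarrow> real^'n \<Rightarrow> 'b" where
  "partial_deriv j f x = vector_derivative (\<lambda>s. f (x + s *\<^sub>R axis j 1)) (at 0)"

definition grad :: "(real^'n::finite \<Rightarrow> real) \<Rightarrow> real^'n \<Rightarrow> real^'n" where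
  "grad f x = (\<chi> j. partial_deriv j f x)"

definition time_deriv :: "real \<Rightarrow> (real \<Rightarrow> 'x \<Rightarrow> real) \<Rightarrow> real \<Rightarrow> 'x \<Rightarrow> real" where
  "time_deriv T f t x = vector_derivative (\<lambda>s. f s x) (at t within {0..T})"

definition flow_residual ::
  "real \<Rightarrow> (real \<Rightarrow> real^'n \<Rightarrow> real) \<Rightarrow> (real \<Rightarrow> real^'n \<Rightarrow> real^'n) \<Rightarrow> real \<Rightarrow> real^'n::finite \<Rightarrow> real" where
  "flow_residual T I w t x = grad (I t) x \<bullet> w t x + time_deriv T I t x"

definition q :: "real \<Rightarrow> real \<Rightarrow> real \<Rightarrow> real" where
  "q \<epsilon> x z = \<bar>x\<bar>\<^sup>2 / (2 * max \<epsilon> \<bar>z\<bar>) + 1 / 2 * max \<epsilon> \<bar>z\<bar>"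

definition harmonic_flow :: "real \<Rightarrow> (real^'n \<Rightarrow> complex^'n) \<Rightarrow> real \<Rightarrow> real^'n \<Rightarrow> real^'n::finite" where
  "harmonic_flow \<omega> a t x = (\<chi> k. Re (a x $ k * exp (\<i> * complex_of_real (\<omega> * t))))"

definition harmonic_flows ::
  "real \<Rightarrow> (real^'n) set \<Rightarrow> real \<Rightarrow> (real \<Rightarrow> real^'n \<Rightarrow> real^'n::finite) set" where
  "harmonic_flows T \<Omega> \<omega> =
    {v. (\<exists>a. v = harmonic_flow \<omega> a) \<and> C2_on ({0..T} \<times> \<Omega>) (\<lambda>(t, x). v t x)}"

text \<open>
  The norm of the type \<open>real^'n^'n\<close> is the Frobenius norm. The integrand is nonnegative when
  \<open>\<epsilon>, \<delta>, \<lambda> > 0\<close>, so the energy is taken in \<open>[0, \<infinity>]\<close>; a Bochner integral would assign energy \<open>0\<close>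
  to a velocity with non-integrable integrand.
\<close>

definition energy ::
  "real \<Rightarrow> (real^'n) set \<Rightarrow> (real \<Rightarrow> real^'n \<Rightarrow> real) \<Rightarrow> real \<Rightarrow> real \<Rightarrow> real \<Rightarrow>
    (real \<Rightarrow> real^'n \<Rightarrow> real^'n) \<Rightarrow> (real \<Rightarrow> real^'n \<Rightarrow> real^'n::finite) \<Rightarrow> ennreal" where
  "energy T \<Omega> I lam \<epsilon> \<delta> u v =
    (\<integral>\<^sup>+x\<in>\<Omega>. (\<integral>\<^sup>+t\<in>{0..T}.
        ennreal (q \<epsilon> (flow_residual T I v t x) (flow_residual T I u t x)
          + lam * q \<delta> (norm (jacobian (v t) (at x))) (norm (jacobian (u t) (at x))))
      \<partial>lborel) \<partial>lborel)"

definition data_weight ::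
  "real \<Rightarrow> real \<Rightarrow> (real \<Rightarrow> real^'n \<Rightarrow> real) \<Rightarrow> (real \<Rightarrow> real^'n \<Rightarrow> real^'n) \<Rightarrow>
    real \<Rightarrow> real^'n::finite \<Rightarrow> real" where
  "data_weight T \<epsilon> I u t x = 1 / max \<epsilon> \<bar>flow_residual T I u t x\<bar>"

definition reg_weight ::
  "real \<Rightarrow> (real \<Rightarrow> real^'n \<Rightarrow> real^'n) \<Rightarrow> real \<Rightarrow> real^'n::finite \<Rightarrow> real" where
  "reg_weight \<delta> u t x = 1 / max \<delta> (norm (jacobian (u t) (at x)))"

definition fourier :: "real \<Rightarrow> (real \<Rightarrow> 'x \<Rightarrow> real) \<Rightarrow> real \<Rightarrow> 'x \<Rightarrow> complex" where
  "fourier T f \<nu> x =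
    (LINT t:{0..T}|lborel. complex_of_real (f t x) * exp (- (\<i> * complex_of_real (t * \<nu>))))"

definition fourier_vec :: "real \<Rightarrow> (real \<Rightarrow> 'x \<Rightarrow> real^'n::finite) \<Rightarrow> real \<Rightarrow> 'x \<Rightarrow> complex^'n" where
  "fourier_vec T f \<nu> x = (\<chi> i. fourier T (\<lambda>t y. f t y $ i) \<nu> x)"

definition fourier_mat ::
  "real \<Rightarrow> (real \<Rightarrow> 'x \<Rightarrow> real^'m::finite^'n::finite) \<Rightarrow> real \<Rightarrow> 'x \<Rightarrow> complex^'m^'n" where
  "fourier_mat T f \<nu> x = (\<chi> i j. fourier T (\<lambda>t y. f t y $ i $ j) \<nu> x)"

definition conj_vec :: "complex^'n \<Rightarrow> complex^'n::finite" where
  "conj_vec a = (\<chi> k. cnj (a $ k))"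

definition outer :: "real^'n \<Rightarrow> real^'n \<Rightarrow> real^'n::finite^'n" where
  "outer a b = (\<chi> i j. a $ i * b $ j)"

definition data_term ::
  "real \<Rightarrow> real \<Rightarrow> real \<Rightarrow> (real \<Rightarrow> real^'n \<Rightarrow> real) \<Rightarrow> (real \<Rightarrow> real^'n \<Rightarrow> real^'n) \<Rightarrow>
    (real^'n \<Rightarrow> complex^'n) \<Rightarrow> real^'n::finite \<Rightarrow> complex^'n" where
  "data_term T \<omega> \<epsilon> I u a x =
    fourier_mat T (\<lambda>t y. data_weight T \<epsilon> I u t y *\<^sub>R outer (grad (I t) y) (grad (I t) y)) 0 x *v a x
    + fourier_mat T (\<lambda>t y. data_weight T \<epsilon> I u t y *\<^sub>R outer (grad (I t) y) (grad (I t) y)) (2 * \<omega>) x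
        *v conj_vec (a x)
    + 2 *\<^sub>R fourier_vec T (\<lambda>t y. (data_weight T \<epsilon> I u t y * time_deriv T I t y) *\<^sub>R grad (I t) y) \<omega> x"

definition reg_flux ::
  "real \<Rightarrow> real \<Rightarrow> real \<Rightarrow> (real \<Rightarrow> real^'n \<Rightarrow> real^'n) \<Rightarrow> (real^'n \<Rightarrow> complex^'n) \<Rightarrow>
    'n::finite \<Rightarrow> real^'n \<Rightarrow> complex^'n" where
  "reg_flux T \<omega> \<delta> u a j x =
    fourier T (reg_weight \<delta> u) 0 x *s partial_deriv j a x
    + fourier T (reg_weight \<delta> u) (2 * \<omega>) x *s conj_vec (partial_deriv j a x)"

text \<open>
  \<open>g = (\<Sum>j. \<partial>\<^sub>j X\<^sub>j)\<close> in the sense of distributions on the open set \<open>\<Omega>\<close>. Testing against \<open>C\<^sup>2\<close>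
  functions with compact support in \<open>\<Omega>\<close> includes testing against all \<open>C\<^sup>\<infinity>\<close> ones.
\<close>

definition has_weak_divergence_on ::
  "('n \<Rightarrow> real^'n \<Rightarrow> 'b::euclidean_space) \<Rightarrow> (real^'n \<Rightarrow> 'b) \<Rightarrow> (real^'n::finite) set \<Rightarrow> bool" where
  "has_weak_divergence_on X g \<Omega> \<longleftrightarrow>
    (\<forall>K. compact K \<and> K \<subseteq> \<Omega> \<longrightarrow>
       set_integrable lborel K g \<and> (\<forall>j. set_integrable lborel K (X j))) \<and>
    (\<forall>\<phi> :: real^'n \<Rightarrow> real.
       C2_on UNIV \<phi> \<and> (\<exists>K. compact K \<and> K \<subseteq> \<Omega> \<and> (\<forall>x. x \<notin> K \<longrightarrow> \<phi> x = 0)) \<longrightarrow>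
       (LINT x:\<Omega>|lborel. \<phi> x *\<^sub>R g x)
         = - (LINT x:\<Omega>|lborel. (\<Sum>j\<in>UNIV. partial_deriv j \<phi> x *\<^sub>R X j x)))"

end

theory Submission
  imports Defs
begin

text \<open>
  The variations of a harmonic flow are \<open>h(t,x) = \<phi>(x) Re (c e\<^sup>i\<^sup>\<omega>\<^sup>t)\<close> with a compactly supported
  test function \<open>\<phi>\<close> and a constant vector \<open>c\<close>. Along \<open>v + s h\<close> the energy density is a quadratic
  polynomial in \<open>s\<close>, so minimality forces the integral of its linear coefficient to vanish.
  Writing \<open>v = Re (a e\<^sup>i\<^sup>\<omega>\<^sup>t)\<close> and integrating in \<open>t\<close> first turns the time integrals into Fourier
  coefficients at the frequencies \<open>0\<close>, \<open>\<omega>\<close> and \<open>2\<omega>\<close>, and the linear coefficient becomes half the real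
  inner product of \<open>c\<close> with \<open>\<phi> D + \<lambda> \<Sum>\<^sub>j \<partial>\<^sub>j\<phi> R\<^sub>j\<close>, where \<open>D\<close> is the data term and \<open>R\<close> the flux. This is
  the weak form of the equation. At a point where \<open>R\<close> is differentiable, testing with bumps that
  concentrate there yields the pointwise equation, since \<open>D\<close> is continuous.
\<close>

section \<open>Functions of class C1 and C2\<close>

text \<open>Since \<open>u\<close> is only C1, the weights are in general merely continuous, and the
  maxima in them would cost smoothness even for better \<open>u\<close>. The flux inherits this and
  need not have derivatives, so the equation is first a distributional one. Minimality is an
  inequality between energies in [0, \<infinity>], which cannot be subtracted. A compactly supported
  variation changes the density only on a compact \<open>K\<close>, and finiteness of the minimal
  energy allows the common part outside \<open>K\<close> to be cancelled; what remains are real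
  integrals of continuous functions. The regularity hypothesis concerns \<open>v\<close>, whereas
  the equation speaks of \<open>a\<close>; the derivative of the amplitude therefore has to be
  recovered from the flow. A variation must stay in the class of C2 flows, so the test functions are
  C2, and concentration at a point is achieved with truncated polynomials. The inner product on
  complex vectors is the real one, so letting \<open>c\<close> run through all of them turns one
  real scalar identity into the complex vector equation.\<close>

text \<open>On a finite-dimensional domain, continuity of an operator-valued map can be tested on
  vectors. Calculus with C1 functions can thus work with plain directional derivatives instead of
  the bounded operators of the definition.\<close>

lemma C1_onI:
  fixes f :: "'a::euclidean_space \<Rightarrow> 'b::real_normed_vector"
  assumes "\<And>z. z \<in> S \<Longrightarrow> (f has_derivative f' z) (at z within S)"
    and "\<And>h. continuous_on S (\<lambda>z. f' z h)"
  shows "C1_on S f"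
proof -
  define F where "F z = (if z \<in> S then Blinfun (f' z) else 0)" for z
  have F: "blinfun_apply (F z) = f' z" if "z \<in> S" for z
    using that assms(1)[OF that] by (simp add: F_def has_derivative_bounded_linear bounded_linear_Blinfun_apply)
  have "continuous_on S F"
    by (intro continuous_on_blinfun_componentwise continuous_on_eq[OF assms(2)]) (simp add: F)
  then show ?thesis
    unfolding C1_on_def using assms(1) F by (intro exI[of _ F]) auto
qed

lemma C1_onD:
  assumes "C1_on S f"
  shows "\<exists>f'. (\<forall>z\<in>S. (f has_derivative f' z) (at z within S)) \<and> (\<forall>h. continuous_on S (\<lambda>z. f' z h))"
proof -
  obtain F where F: "\<forall>z\<in>S. (f has_derivative blinfun_apply (F z)) (at z within S)" "continuous_on S F"
    using assms unfolding C1_on_def by blast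
  have "continuous_on S (\<lambda>z. blinfun_apply (F z) h)" for h
    by (intro continuous_intros F)
  with F show ?thesis by (intro exI[of _ "\<lambda>z. blinfun_apply (F z)"]) blast
qed

lemma C2_onD: "C2_on S f \<Longrightarrow> C1_on S f"
  unfolding C2_on_def C1_on_def
  by (meson has_derivative_continuous continuous_on_eq_continuous_within)

lemma C1_on_imp_continuous_on: "C1_on S f \<Longrightarrow> continuous_on S f"
  unfolding C1_on_def by (meson has_derivative_continuous continuous_on_eq_continuous_within)

lemma C1_on_bounded_linear_affine:
  assumes "bounded_linear f"
  shows "C1_on S (\<lambda>x. c + f (x - x0))"
proof -
  interpret bounded_linear f by fact
  have "((\<lambda>x. f (x - x0)) has_derivative (\<lambda>h. f (h - 0))) (at z within S)" for z
    by (intro has_derivative has_derivative_diff has_derivative_ident has_derivative_const)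
  from has_derivative_add[OF has_derivative_const this]
  have "((\<lambda>x. c + f (x - x0)) has_derivative f) (at z within S)" for z
    by simp
  then show ?thesis
    unfolding C1_on_def
    by (intro exI[of _ "\<lambda>_. Blinfun f"]) (simp add: bounded_linear_Blinfun_apply assms)
qed

lemma C1_on_const: "C1_on S (\<lambda>x. c)"
  using C1_on_bounded_linear_affine[of "\<lambda>_. 0" S c 0] by (simp add: bounded_linear_zero)

lemma C2_on_bounded_linear_affine:
  assumes "bounded_linear f"
  shows "C2_on S (\<lambda>x. c + f (x - x0))"
proof -
  interpret bounded_linear f by fact
  have "((\<lambda>x. f (x - x0)) has_derivative (\<lambda>h. f (h - 0))) (at z within S)" for z
    by (intro has_derivative has_derivative_diff has_derivative_ident has_derivative_const)
  from has_derivative_add[OF has_derivative_const this]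
  have "((\<lambda>x. c + f (x - x0)) has_derivative f) (at z within S)" for z
    by simp
  then show ?thesis
    unfolding C2_on_def
    by (intro exI[of _ "\<lambda>_. Blinfun f"]) (simp add: bounded_linear_Blinfun_apply assms C1_on_const)
qed

text \<open>Arbitrary bounded bilinear maps are allowed so that the rule also covers scaling and
  composition of operator-valued functions. This is how the product and chain rules below reach C2:
  the derivative they produce is itself bilinear in C1 data.\<close>

lemma C1_on_bilinear:
  fixes f :: "'a::euclidean_space \<Rightarrow> 'b::real_normed_vector"
  assumes "bounded_bilinear mul" "C1_on S f" "C1_on S g"
  shows "C1_on S (\<lambda>x. mul (f x) (g x))"
proof -
  interpret bounded_bilinear mul by fact
  obtain f' where f: "\<forall>z\<in>S. (f has_derivative f' z) (at z within S)"
    "\<forall>h. continuous_on S (\<lambda>z. f' z h)" using C1_onD[OF assms(2)] by auto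
  obtain g' where g: "\<forall>z\<in>S. (g has_derivative g' z) (at z within S)"
    "\<forall>h. continuous_on S (\<lambda>z. g' z h)" using C1_onD[OF assms(3)] by auto
  show ?thesis
  proof (rule C1_onI)
    show "((\<lambda>x. mul (f x) (g x)) has_derivative (\<lambda>h. mul (f z) (g' z h) + mul (f' z h) (g z))) (at z within S)"
      if "z \<in> S" for z
      using FDERIV[OF f(1)[rule_format, OF that] g(1)[rule_format, OF that]] .
    show "continuous_on S (\<lambda>z. mul (f z) (g' z h) + mul (f' z h) (g z))" for h
      using f(2) g(2) assms(2,3)[THEN C1_on_imp_continuous_on] by (intro continuous_on_add continuous_on) auto
  qed
qed

lemma C1_on_add:
  assumes "C1_on S f" "C1_on S g"
  shows "C1_on S (\<lambda>x. f x + g x)"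
proof -
  from assms obtain f' g' where
    "\<forall>z\<in>S. (f has_derivative blinfun_apply (f' z)) (at z within S)" "continuous_on S f'"
    "\<forall>z\<in>S. (g has_derivative blinfun_apply (g' z)) (at z within S)" "continuous_on S g'"
    unfolding C1_on_def by blast
  then show ?thesis
    unfolding C1_on_def
    by (intro exI[of _ "\<lambda>z. f' z + g' z"])
      (auto simp: plus_blinfun.rep_eq intro!: has_derivative_add continuous_on_add)
qed

lemma C2_on_add:
  assumes "C2_on S f" "C2_on S g"
  shows "C2_on S (\<lambda>x. f x + g x)"
proof -
  from assms obtain f' g' where
    "\<forall>z\<in>S. (f has_derivative blinfun_apply (f' z)) (at z within S)" "C1_on S f'"
    "\<forall>z\<in>S. (g has_derivative blinfun_apply (g' z)) (at z within S)" "C1_on S g'"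
    unfolding C2_on_def by blast
  then show ?thesis
    unfolding C2_on_def
    by (intro exI[of _ "\<lambda>z. f' z + g' z"])
      (auto simp: plus_blinfun.rep_eq intro!: has_derivative_add C1_on_add)
qed

lemma C1_on_compose_bounded_linear_left:
  fixes g :: "'a::euclidean_space \<Rightarrow> 'b::real_normed_vector"
  assumes "bounded_linear f" "C1_on S g"
  shows "C1_on S (\<lambda>x. f (g x))"
proof -
  obtain g' where g: "\<forall>z\<in>S. (g has_derivative g' z) (at z within S)"
    "\<forall>h. continuous_on S (\<lambda>z. g' z h)" using C1_onD[OF assms(2)] by auto
  show ?thesis
    by (rule C1_onI, erule bounded_linear.has_derivative[OF assms(1) g(1)[rule_format]])
      (intro bounded_linear.continuous_on[OF assms(1)] g(2)[rule_format])
qed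

lemma C2_on_scaleR:
  fixes f :: "'a::euclidean_space \<Rightarrow> real" and g :: "'a \<Rightarrow> 'b::real_normed_vector"
  assumes "C2_on S f" "C2_on S g"
  shows "C2_on S (\<lambda>x. f x *\<^sub>R g x)"
proof -
  from assms obtain f' g' where *:
    "\<forall>z\<in>S. (f has_derivative blinfun_apply (f' z)) (at z within S)" "C1_on S f'"
    "\<forall>z\<in>S. (g has_derivative blinfun_apply (g' z)) (at z within S)" "C1_on S g'"
    unfolding C2_on_def by blast
  let ?D = "\<lambda>z. f z *\<^sub>R g' z + (blinfun_scaleR_left (g z) o\<^sub>L f' z)"
  have "C1_on S ?D"
    by (intro C1_on_add C1_on_bilinear[OF bounded_bilinear_scaleR]
        C1_on_bilinear[OF bounded_bilinear_blinfun_compose]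
        C1_on_compose_bounded_linear_left[OF bounded_linear_blinfun_scaleR_left] assms[THEN C2_onD] *)
  moreover have "((\<lambda>x. f x *\<^sub>R g x) has_derivative blinfun_apply (?D z)) (at z within S)" if "z \<in> S" for z
    using has_derivative_scaleR[OF *(1)[rule_format, OF that] *(3)[rule_format, OF that]]
    by (simp add: plus_blinfun.rep_eq scaleR_blinfun.rep_eq blinfun_compose.rep_eq)
  ultimately show ?thesis
    unfolding C2_on_def by (intro exI[of _ ?D]) simp
qed

lemma C1_on_chain_real:
  fixes f :: "'a::euclidean_space \<Rightarrow> real"
  assumes "\<And>s. (m has_real_derivative m' s) (at s)" "continuous_on UNIV m'" "C1_on S f"
  shows "C1_on S (\<lambda>x. m (f x))"
proof -
  obtain f' where f: "\<forall>z\<in>S. (f has_derivative f' z) (at z within S)"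
    "\<forall>h. continuous_on S (\<lambda>z. f' z h)" using C1_onD[OF assms(3)] by auto
  show ?thesis
    by (rule C1_onI, rule DERIV_compose_FDERIV[OF assms(1) f(1)[rule_format]], assumption)
      (intro continuous_intros f(2)[rule_format] continuous_on_compose2[OF assms(2)]
        C1_on_imp_continuous_on[OF assms(3)] subset_UNIV)
qed

lemma C2_on_chain_real:
  fixes f :: "'a::euclidean_space \<Rightarrow> real"
  assumes "\<And>s. (m has_real_derivative m' s) (at s)" "\<And>s. (m' has_real_derivative m'' s) (at s)"
    "continuous_on UNIV m''" "C2_on S f"
  shows "C2_on S (\<lambda>x. m (f x))"
proof -
  from assms(4) obtain f' where *:
    "\<forall>z\<in>S. (f has_derivative blinfun_apply (f' z)) (at z within S)" "C1_on S f'"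
    unfolding C2_on_def by blast
  have "C1_on S (\<lambda>z. m' (f z) *\<^sub>R f' z)"
    by (intro C1_on_bilinear[OF bounded_bilinear_scaleR] C1_on_chain_real[OF assms(2,3)] C2_onD[OF assms(4)] *)
  moreover have "((\<lambda>x. m (f x)) has_derivative blinfun_apply (m' (f z) *\<^sub>R f' z)) (at z within S)"
    if "z \<in> S" for z
    using DERIV_compose_FDERIV[OF assms(1) *(1)[rule_format, OF that]]
    by (simp add: scaleR_blinfun.rep_eq mult.commute)
  ultimately show ?thesis
    unfolding C2_on_def by (intro exI[of _ "\<lambda>z. m' (f z) *\<^sub>R f' z"]) simp
qed

text \<open>Lifts a test function of \<open>x\<close> to a function of \<open>(t, x)\<close> along
  the projection \<open>snd\<close>.\<close>

lemma C2_on_compose_bounded_linear: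
  fixes L :: "'a::euclidean_space \<Rightarrow> 'b::euclidean_space" and f :: "'b \<Rightarrow> 'c::real_normed_vector"
  assumes "bounded_linear L" "C2_on UNIV f"
  shows "C2_on S (\<lambda>x. f (L x))"
proof -
  interpret bounded_linear L by fact
  from assms(2) obtain f' where *:
    "\<And>z. (f has_derivative blinfun_apply (f' z)) (at z)" "C1_on UNIV f'"
    unfolding C2_on_def by auto
  obtain f'' where f'': "\<forall>z. (f' has_derivative f'' z) (at z)"
    "\<forall>h. continuous_on UNIV (\<lambda>z. f'' z h)" using C1_onD[OF *(2)] by auto
  have L: "(L has_derivative L) (at z within S)" for z
    by (rule bounded_linear_imp_has_derivative[OF assms(1)])
  have "C1_on S (\<lambda>z. f' (L z))"
    by (rule C1_onI, rule has_derivative_compose[OF L f''(1)[rule_format]])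
      (intro continuous_on_compose2[OF f''(2)[rule_format]] continuous_on[OF continuous_on_id] subset_UNIV)
  then have "C1_on S (\<lambda>z. f' (L z) o\<^sub>L Blinfun L)"
    by (intro C1_on_bilinear[OF bounded_bilinear_blinfun_compose] C1_on_const)
  moreover have "((\<lambda>x. f (L x)) has_derivative blinfun_apply (f' (L z) o\<^sub>L Blinfun L)) (at z within S)" for z
    using has_derivative_compose[OF L *(1)[of "L z"]] by (simp add: o_def blinfun_compose.rep_eq bounded_linear_Blinfun_apply assms(1))
  ultimately show ?thesis
    unfolding C2_on_def by (intro exI[of _ "\<lambda>z. f' (L z) o\<^sub>L Blinfun L"]) simp
qed

section \<open>Weak and pointwise divergence\<close>

lemma integrable_continuous_compact_support:
  fixes f :: "'a::euclidean_space \<Rightarrow> 'b::{banach, second_countable_topology}"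
  assumes "compact K" "continuous_on K f" "\<And>x. x \<notin> K \<Longrightarrow> f x = 0"
  shows "integrable lborel f"
  by (rule iffD1[OF Bochner_Integration.integrable_cong borel_integrable_compact[OF assms(1,2)]])
    (use assms(3) in \<open>auto simp: indicator_def\<close>)

text \<open>A weak divergence gives only local integrability of \<open>f\<close>; the continuous
  factor is bounded on the compact set and vanishes off it.\<close>

lemma integrable_scaleR_compact_support:
  fixes f :: "'a::euclidean_space \<Rightarrow> 'b::{banach, second_countable_topology}"
  assumes "compact K" "set_integrable lborel K f" "continuous_on UNIV \<phi>" "\<And>x. x \<notin> K \<Longrightarrow> \<phi> x = 0"
  shows "integrable lborel (\<lambda>x. \<phi> x *\<^sub>R f x)"
proof -
  have "compact (\<phi> ` K)"
    using assms(1,3) by (blast intro: compact_continuous_image continuous_on_subset)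
  then obtain B where B: "\<And>x. x \<in> K \<Longrightarrow> \<bar>\<phi> x\<bar> \<le> B"
    by (force dest!: compact_imp_bounded simp: bounded_iff)
  have "integrable lborel (\<lambda>x. \<phi> x *\<^sub>R (indicator K x *\<^sub>R f x))"
  proof (rule Bochner_Integration.integrable_bound)
    show int: "integrable lborel (\<lambda>x. B *\<^sub>R (indicator K x *\<^sub>R f x))"
      using assms(2) unfolding set_integrable_def by (rule integrable_scaleR_right)
    have "(\<lambda>x. indicator K x *\<^sub>R f x) \<in> borel_measurable lborel"
      using assms(2) unfolding set_integrable_def by (rule borel_measurable_integrable)
    moreover have "\<phi> \<in> borel_measurable lborel"
      using assms(3) borel_measurable_continuous_onI by simp
    ultimately show "(\<lambda>x. \<phi> x *\<^sub>R (indicator K x *\<^sub>R f x)) \<in> borel_measurable lborel"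
      by (rule borel_measurable_scaleR[rotated])
    show "AE x in lborel. norm (\<phi> x *\<^sub>R (indicator K x *\<^sub>R f x)) \<le> norm (B *\<^sub>R (indicator K x *\<^sub>R f x))"
      using B by (intro AE_I2) (force simp: indicator_def intro!: mult_right_mono)
  qed
  moreover have "(\<lambda>x. \<phi> x *\<^sub>R (indicator K x *\<^sub>R f x)) = (\<lambda>x. \<phi> x *\<^sub>R f x)"
    using assms(4) by (intro ext) (metis indicator_simps(1) scaleR_one scaleR_zero_left)
  ultimately show ?thesis by (simp only:)
qed

lemma has_derivative_zero_off_support:
  assumes "(f has_derivative f') (at x)" "closed K" "x \<notin> K" "\<And>x. x \<notin> K \<Longrightarrow> f x = 0"
  shows "f' = (\<lambda>_. 0)"
proof -
  have "(f has_derivative (\<lambda>_. 0)) (at x)"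
    by (rule has_derivative_transform_within_open[OF has_derivative_const[of 0] open_Compl[OF assms(2)]])
      (use assms(3,4) in auto)
  then show ?thesis
    by (rule has_derivative_unique[OF assms(1)])
qed

lemma lborel_integral_translate:
  fixes f :: "'a::euclidean_space \<Rightarrow> 'b::{banach, second_countable_topology}"
  assumes "f \<in> borel_measurable borel"
  shows "(\<integral>x. f (c + x) \<partial>lborel) = (\<integral>x. f x \<partial>lborel)"
proof -
  have "(\<integral>x. f x \<partial>distr lborel borel ((+) c)) = (\<integral>x. f (c + x) \<partial>lborel)"
    by (rule integral_distr) (use assms in auto)
  then show ?thesis by (simp add: lborel_distr_plus)
qed

text \<open>By translation invariance of Lebesgue measure every difference quotient in direction
  \<open>e\<close> has integral zero, and dominated convergence carries this to the
  derivative.\<close>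

lemma integral_directional_derivative_eq_0:
  fixes f :: "'a::euclidean_space \<Rightarrow> 'b::euclidean_space"
  assumes K: "compact K" "\<And>x. x \<notin> K \<Longrightarrow> f x = 0"
    and f': "\<And>x. (f has_derivative f' x) (at x)" "continuous_on UNIV (\<lambda>x. f' x e)"
  shows "(\<integral>x. f' x e \<partial>lborel) = 0"
proof -
  \<comment> \<open>Difference quotient with step \<open>1 / Suc n\<close>; inside this proof the
    name does not refer to the energy function \<open>q\<close>.\<close>
  define q where "q n x = real (Suc n) *\<^sub>R (f (inverse (real (Suc n)) *\<^sub>R e + x) - f x)" for n x
  have cf: "continuous_on UNIV f"
    by (intro continuous_at_imp_continuous_on ballI has_derivative_continuous[OF f'(1)])
  have f0: "f' x = (\<lambda>_. 0)" if "x \<notin> K" for x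
    by (rule has_derivative_zero_off_support[OF f'(1) _ that K(2)]) (simp add: K compact_imp_closed)
  have "compact ((\<lambda>x. f' x e) ` K)"
    using K f'(2) by (blast intro: compact_continuous_image continuous_on_subset)
  then obtain B0 where B0: "\<And>x. x \<in> K \<Longrightarrow> norm (f' x e) \<le> B0"
    by (force dest!: compact_imp_bounded simp: bounded_iff)
  define B where "B = max 0 B0"
  have B: "norm (f' x e) \<le> B" for x
    using B0[of x] f0[of x] by (cases "x \<in> K") (auto simp: B_def)
  obtain R where R: "\<And>x. x \<in> K \<Longrightarrow> norm x \<le> R"
    using compact_imp_bounded[OF K(1)] by (auto simp: bounded_iff)
  have deriv: "((\<lambda>s. f (s *\<^sub>R e + x)) has_derivative (\<lambda>t. t *\<^sub>R f' (s *\<^sub>R e + x) e)) (at s within S)" for s x S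
  proof -
    have "((\<lambda>s. f (s *\<^sub>R e + x)) has_derivative (\<lambda>t. f' (s *\<^sub>R e + x) (t *\<^sub>R e))) (at s within S)"
      by (rule has_derivative_compose[OF _ f'(1)]) (auto intro!: derivative_eq_intros)
    then show ?thesis
      by (simp add: linear_simps(5)[OF has_derivative_bounded_linear[OF f'(1)]])
  qed
  have meas: "f \<in> borel_measurable borel" "q n \<in> borel_measurable borel" for n
    unfolding q_def by (intro borel_measurable_continuous_onI continuous_intros continuous_on_compose2[OF cf]; simp add: cf)+
  have intf: "integrable lborel f"
    by (rule integrable_continuous_compact_support[OF K(1) continuous_on_subset[OF cf] K(2)]) auto
  have intt: "integrable lborel (\<lambda>x. f (c + x))" for c
  proof -
    have "integrable (distr lborel borel ((+) c)) f"
      using intf by (simp add: lborel_distr_plus)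
    then show ?thesis
      by (subst (asm) integrable_distr_eq) (use meas(1) in auto)
  qed
  have q0: "(\<integral>x. q n x \<partial>lborel) = 0" for n
  proof -
    have "(\<integral>x. q n x \<partial>lborel) = real (Suc n) *\<^sub>R ((\<integral>x. f (inverse (real (Suc n)) *\<^sub>R e + x) \<partial>lborel) - (\<integral>x. f x \<partial>lborel))"
      unfolding q_def using intf intt by (subst integral_scaleR_right, subst Bochner_Integration.integral_diff) auto
    then show ?thesis using lborel_integral_translate[OF meas(1)] by simp
  qed
  have "(\<lambda>n. \<integral>x. q n x \<partial>lborel) \<longlonglongrightarrow> (\<integral>x. f' x e \<partial>lborel)"
  proof (rule integral_dominated_convergence)
    show "(\<lambda>x. f' x e) \<in> borel_measurable lborel"
      using f'(2) by (simp add: borel_measurable_continuous_onI)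
    show "q n \<in> borel_measurable lborel" for n using meas(2) by simp
    \<comment> \<open>The mean value inequality bounds each quotient by \<open>B\<close>. Steps are
      at most 1, so beyond radius \<open>R + norm e\<close> both \<open>x\<close> and its translate
      lie outside \<open>K\<close>.\<close>
    show "integrable lborel (\<lambda>x::'a. indicator (cball 0 (R + norm e)) x *\<^sub>R B)"
      by (intro borel_integrable_compact) auto
    show "AE x in lborel. (\<lambda>n. q n x) \<longlonglongrightarrow> f' x e"
    proof (rule AE_I2)
      fix x
      let ?g = "\<lambda>h. (f (h *\<^sub>R e + x) - f x) /\<^sub>R h"
      have lim: "((\<lambda>h. norm (f (h *\<^sub>R e + x) - f x - h *\<^sub>R f' x e) / norm h) \<longlongrightarrow> 0) (at 0)"
        using deriv[of x 0 UNIV] by (simp add: has_derivative_at)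
      have eq: "norm (f (h *\<^sub>R e + x) - f x - h *\<^sub>R f' x e) / norm h = norm (?g h - f' x e)" if "h \<noteq> 0" for h
      proof -
        have "f (h *\<^sub>R e + x) - f x - h *\<^sub>R f' x e = h *\<^sub>R (?g h - f' x e)"
          using that by (simp add: scaleR_diff_right)
        then show ?thesis using that by simp
      qed
      have "((\<lambda>h. norm (?g h - f' x e)) \<longlongrightarrow> 0) (at 0)"
        by (rule Lim_transform_within[OF lim zero_less_one]) (rule eq, simp)
      then have "(?g \<longlongrightarrow> f' x e) (at 0)"
        by (rule LIM_zero_cancel[OF tendsto_norm_zero_cancel])
      moreover have "filterlim (\<lambda>n. inverse (real (Suc n))) (at 0) sequentially"
        using LIMSEQ_inverse_real_of_nat by (auto simp: filterlim_at simp del: of_nat_Suc)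
      ultimately have "(\<lambda>n. (f (inverse (real (Suc n)) *\<^sub>R e + x) - f x) /\<^sub>R inverse (real (Suc n))) \<longlonglongrightarrow> f' x e"
        by (rule filterlim_compose)
      then show "(\<lambda>n. q n x) \<longlonglongrightarrow> f' x e"
        by (simp add: q_def)
    qed
    show "AE x in lborel. norm (q n x) \<le> indicator (cball 0 (R + norm e)) x *\<^sub>R B" for n
    proof (rule AE_I2)
      fix x
      define s where "s = inverse (real (Suc n))"
      have s: "0 < s" "s \<le> 1" by (auto simp: s_def field_simps)
      have "norm (f (s *\<^sub>R e + x) - f (0 *\<^sub>R e + x)) \<le> B * norm (s - 0)"
        by (rule differentiable_bound[of "{0..s}", OF _ deriv])
          (use s in \<open>auto intro!: onorm_le simp: mult.commute[of B] mult_left_mono B\<close>)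
      moreover have sn: "real (Suc n) = inverse s" by (simp add: s_def)
      have "norm (q n x) = norm (f (s *\<^sub>R e + x) - f x) / s"
        unfolding q_def s_def[symmetric] unfolding sn norm_scaleR using s by (simp add: divide_inverse mult.commute)
      ultimately have "norm (q n x) \<le> B"
        using s by (simp add: pos_divide_le_eq)
      moreover have "q n x = 0" if "x \<notin> cball 0 (R + norm e)"
      proof -
        have "norm (s *\<^sub>R e) \<le> norm e" using s by (simp add: mult_left_le_one_le)
        moreover have "norm x \<le> norm (s *\<^sub>R e + x) + norm (s *\<^sub>R e)"
          using norm_triangle_ineq4[of "s *\<^sub>R e + x" "s *\<^sub>R e"] by simp
        moreover have "norm x > R + norm e" using that by simp
        ultimately have "\<not> norm x \<le> R" "\<not> norm (s *\<^sub>R e + x) \<le> R"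
          using norm_ge_zero[of e] by linarith+
        then have "x \<notin> K" "s *\<^sub>R e + x \<notin> K"
          using R by blast+
        then show ?thesis using K(2) by (simp add: q_def s_def)
      qed
      ultimately show "norm (q n x) \<le> indicator (cball 0 (R + norm e)) x *\<^sub>R B"
        by (cases "x \<in> cball 0 (R + norm e)") auto
    qed
  qed
  then show ?thesis
    by (simp add: q0 LIMSEQ_const_iff)
qed

section \<open>Bump functions of class C2 and the first moments of their gradients\<close>

lemma has_real_derivative_max_0_power:
  "((\<lambda>s::real. max 0 s ^ Suc (Suc k)) has_real_derivative real (Suc (Suc k)) * max 0 s ^ Suc k) (at s)"
proof (cases s "0::real" rule: linorder_cases)
  case less
  have "((\<lambda>s::real. 0) has_real_derivative real (Suc (Suc k)) * max 0 s ^ Suc k) (at s)"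
    using less by (auto intro!: derivative_eq_intros)
  then show ?thesis
    by (rule has_field_derivative_transform_within_open[of _ _ _ "{..<0}"]) (use less in auto)
next
  case greater
  have "((\<lambda>s::real. s ^ Suc (Suc k)) has_real_derivative real (Suc (Suc k)) * max 0 s ^ Suc k) (at s)"
    using DERIV_pow[of "Suc (Suc k)" s UNIV] greater by (simp add: max_def)
  then show ?thesis
    by (rule has_field_derivative_transform_within_open[of _ _ _ "{0<..}"]) (use greater in auto)
next
  case equal
  \<comment> \<open>At the kink the difference quotient equals \<open>max 0 h ^ Suc k\<close>
    exactly, and its exponent is at least one, so it tends to 0. This is why the powers start at
    two.\<close>
  have "((\<lambda>h::real. max 0 h ^ Suc k) \<longlongrightarrow> max 0 0 ^ Suc k) (at 0)"
    by (intro tendsto_intros)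
  then have "((\<lambda>h::real. max 0 h ^ Suc k) \<longlongrightarrow> 0) (at 0)" by simp
  moreover have "\<forall>\<^sub>F h::real in at 0. max 0 h ^ Suc k = (max 0 (0 + h) ^ Suc (Suc k) - max 0 0 ^ Suc (Suc k)) / h"
    by (auto simp: eventually_at_filter max_def)
  ultimately have "((\<lambda>h::real. (max 0 (0 + h) ^ Suc (Suc k) - max 0 0 ^ Suc (Suc k)) / h) \<longlongrightarrow> 0) (at 0)"
    by (rule Lim_transform_eventually)
  then show ?thesis
    using equal by (simp add: DERIV_def)
qed


text \<open>The cube is the least integer power of the truncated paraboloid that is C2 across the
  sphere of radius \<open>r\<close>, and C2 is what \<open>has_weak_divergence_on\<close> asks of
  its test functions. A polynomial profile makes the gradient an explicit nonpositive multiple of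
  \<open>x - x0\<close>.\<close>

definition bump :: "real \<Rightarrow> 'a::euclidean_space \<Rightarrow> 'a \<Rightarrow> real" where
  "bump r x0 x = max 0 (r\<^sup>2 - (x - x0) \<bullet> (x - x0)) ^ 3"

definition bump' :: "real \<Rightarrow> 'a::euclidean_space \<Rightarrow> 'a \<Rightarrow> 'a \<Rightarrow> real" where
  "bump' r x0 x h = - 6 * max 0 (r\<^sup>2 - (x - x0) \<bullet> (x - x0)) ^ 2 * ((x - x0) \<bullet> h)"

lemma continuous_on_bump: "continuous_on S (bump r x0)" "continuous_on S (\<lambda>x. bump' r x0 x h)"
  unfolding bump_def[abs_def] bump'_def by (intro continuous_intros)+

lemma bump_nonneg: "bump r x0 x \<ge> 0"
  by (simp add: bump_def)

lemma bump_eq_0: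
  assumes "x \<notin> cball x0 r" "r > 0"
  shows "bump r x0 x = 0" "bump' r x0 x h = 0"
proof -
  have "r \<le> norm (x - x0)" using assms by (simp add: dist_norm norm_minus_commute)
  then have "r\<^sup>2 \<le> (norm (x - x0))\<^sup>2" using assms by (intro power_mono) auto
  then show "bump r x0 x = 0" "bump' r x0 x h = 0"
    by (simp_all add: bump_def bump'_def power2_norm_eq_inner)
qed

lemma
  shows bump_has_derivative: "(bump r x0 has_derivative bump' r x0 x) (at x within S)"
    and C2_on_bump: "C2_on S (bump r x0)"
proof -
  let ?\<rho> = "\<lambda>x. r\<^sup>2 - (x - x0) \<bullet> (x - x0)"
  have \<rho>: "(?\<rho> has_derivative (\<lambda>h. - (2 * ((x - x0) \<bullet> h)))) (at x within S)" for x S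
    by (auto intro!: derivative_eq_intros simp: inner_commute)
  have m: "((\<lambda>s::real. max 0 s ^ 3) has_real_derivative 3 * max 0 s ^ 2) (at s)"
          "((\<lambda>s::real. 3 * max 0 s ^ 2) has_real_derivative 3 * (2 * max 0 s)) (at s)" for s
    using has_real_derivative_max_0_power[of 1 s] DERIV_cmult[OF has_real_derivative_max_0_power[of 0 s], of 3]
    by (simp_all add: numeral_eq_Suc)
  show "(bump r x0 has_derivative bump' r x0 x) (at x within S)"
    using DERIV_compose_FDERIV[OF m(1) \<rho>, of x S]
    by (simp add: bump_def[abs_def] bump'_def[abs_def] algebra_simps)
  \<comment> \<open>The derivative of the paraboloid, as an operator-valued map, is affine in
    \<open>x\<close>.\<close>
  have "C1_on S (\<lambda>x. 0 + (- 2) *\<^sub>R blinfun_inner_left (x - x0))"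
    by (rule C1_on_bounded_linear_affine) (intro bounded_linear_intros)
  then have "C2_on S ?\<rho>"
    unfolding C2_on_def using \<rho>
    by (intro exI[of _ "\<lambda>x. 0 + (- 2) *\<^sub>R blinfun_inner_left (x - x0)"])
      (simp add: scaleR_blinfun.rep_eq plus_blinfun.rep_eq inner_commute uminus_blinfun.rep_eq)
  moreover have "continuous_on UNIV (\<lambda>s::real. 3 * (2 * max 0 s))"
    by (intro continuous_intros)
  ultimately have "C2_on S (\<lambda>x. max 0 (?\<rho> x) ^ 3)"
    by (intro C2_on_chain_real[OF m])
  then show "C2_on S (bump r x0)"
    by (simp add: bump_def[abs_def])
qed

lemma bump_integrable:
  assumes "r > 0"
  shows "integrable lborel (bump r x0)"
  by (rule integrable_continuous_compact_support[of "cball x0 r"])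
    (use assms in \<open>auto intro: continuous_on_bump bump_eq_0\<close>)

lemma bump_integral_pos:
  assumes "r > 0"
  shows "(\<integral>x. bump r x0 x \<partial>lborel) > 0"
proof -
  \<comment> \<open>On the ball of half the radius the paraboloid is at least
    \<open>r^2 - (r/2)^2\<close>, which is three quarters of \<open>r^2\<close>.\<close>
  let ?c = "(3 / 4 * r\<^sup>2) ^ 3"
  have "0 < ?c * measure lborel (cball x0 (r/2))"
    using assms content_cball_pos[of "r/2" x0] by (intro mult_pos_pos) auto
  also have "\<dots> = (\<integral>x. indicator (cball x0 (r/2)) x *\<^sub>R ?c \<partial>lborel)"
    by simp
  also have "\<dots> \<le> (\<integral>x. bump r x0 x \<partial>lborel)"
  proof (rule integral_mono)
    show "integrable lborel (\<lambda>x. indicator (cball x0 (r/2)) x *\<^sub>R ?c)"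
      by (intro borel_integrable_compact) auto
    show "indicator (cball x0 (r/2)) x *\<^sub>R ?c \<le> bump r x0 x" for x
    proof (cases "x \<in> cball x0 (r/2)")
      case True
      then have "(norm (x - x0))\<^sup>2 \<le> (r/2)\<^sup>2"
        by (intro power_mono) (auto simp: dist_norm norm_minus_commute)
      then have "3 / 4 * r\<^sup>2 \<le> r\<^sup>2 - (x - x0) \<bullet> (x - x0)"
        by (simp add: power2_norm_eq_inner power_divide)
      then have "3 / 4 * r\<^sup>2 \<le> max 0 (r\<^sup>2 - (x - x0) \<bullet> (x - x0))"
        by (rule max.coboundedI2)
      then have "?c \<le> bump r x0 x" unfolding bump_def by (rule power_mono) simp
      with True show ?thesis by simp
    qed (simp add: bump_nonneg)
  qed (rule bump_integrable[OF assms])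
  finally show ?thesis .
qed

text \<open>Makes the constant term in the Taylor expansion of the flux disappear.\<close>

lemma integral_bump':
  assumes "r > 0"
  shows "(\<integral>x. bump' r x0 x e \<partial>lborel) = 0"
  by (rule integral_directional_derivative_eq_0[of "cball x0 r" "bump r x0" "bump' r x0"])
    (use assms in \<open>auto simp: bump_eq_0 bump_has_derivative continuous_on_bump\<close>)

text \<open>Integration by parts: the product of the bump with \<open>L (x - x0)\<close> has compact
  support, so its derivative in direction \<open>e\<close> has integral zero. Taking the derivative
  of the flux for \<open>L\<close> produces the divergence, and taking a coordinate produces the
  moment that controls the remainder.\<close>

lemma integral_bump'_linear:
  fixes L :: "'a::euclidean_space \<Rightarrow> 'b::euclidean_space"
  assumes "r > 0" "bounded_linear L"
  shows "integrable lborel (\<lambda>x. bump' r x0 x e *\<^sub>R L (x - x0))"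
    and "(\<integral>x. bump' r x0 x e *\<^sub>R L (x - x0) \<partial>lborel) = - (\<integral>x. bump r x0 x \<partial>lborel) *\<^sub>R L e"
proof -
  interpret L: bounded_linear L by fact
  have c: "continuous_on S (\<lambda>x. L (x - x0))" for S
    by (intro L.continuous_on continuous_intros)
  show i: "integrable lborel (\<lambda>x. bump' r x0 x e *\<^sub>R L (x - x0))"
    by (rule integrable_continuous_compact_support[of "cball x0 r"])
      (use assms in \<open>auto simp: bump_eq_0 intro!: continuous_intros continuous_on_bump c\<close>)
  have "((\<lambda>x. bump r x0 x *\<^sub>R L (x - x0)) has_derivative
      (\<lambda>h. bump r x0 x *\<^sub>R L h + bump' r x0 x h *\<^sub>R L (x - x0))) (at x)" for x
  proof -
    have "((\<lambda>x. L (x - x0)) has_derivative (\<lambda>h. L (h - 0))) (at x)"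
      by (intro L.has_derivative has_derivative_diff has_derivative_ident has_derivative_const)
    then show ?thesis
      using has_derivative_scaleR[OF bump_has_derivative] by fastforce
  qed
  then have "(\<integral>x. bump r x0 x *\<^sub>R L e + bump' r x0 x e *\<^sub>R L (x - x0) \<partial>lborel) = 0"
    by (rule integral_directional_derivative_eq_0[of "cball x0 r", rotated 2])
      (use assms in \<open>auto simp: bump_eq_0 intro!: continuous_intros continuous_on_bump c\<close>)
  then have "(\<integral>x. bump r x0 x *\<^sub>R L e \<partial>lborel) + (\<integral>x. bump' r x0 x e *\<^sub>R L (x - x0) \<partial>lborel) = 0"
    by (subst (asm) Bochner_Integration.integral_add[OF integrable_scaleR_left[OF bump_integrable] i]) (use assms in auto)
  then show "(\<integral>x. bump' r x0 x e *\<^sub>R L (x - x0) \<partial>lborel) = - (\<integral>x. bump r x0 x \<partial>lborel) *\<^sub>R L e"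
    by (simp add: eq_neg_iff_add_eq_0 add.commute bump_integrable[OF assms(1)])
qed

section \<open>From the distributional divergence to the pointwise one\<close>

lemma partial_deriv_eq:
  assumes "(f has_derivative f') (at x)"
  shows "partial_deriv j f x = f' (axis j 1)"
proof -
  have "((\<lambda>s. f (x + s *\<^sub>R axis j 1)) has_derivative (\<lambda>s. f' (s *\<^sub>R axis j 1))) (at 0)"
    by (rule has_derivative_compose[where g = f]) (use assms in \<open>auto intro!: derivative_eq_intros\<close>)
  then show ?thesis
    unfolding partial_deriv_def
    by (intro vector_derivative_at)
      (simp add: has_vector_derivative_def linear_simps(5)[OF has_derivative_bounded_linear[OF assms]])
qed

text \<open>
  The remainder of \<open>X j\<close> at \<open>x0\<close> is at most \<open>\<eta> |x - x0|\<close>, and \<open>|\<nabla>bump| |x - x0|\<close> equals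
  \<open>- \<Sum>\<^sub>j \<partial>\<^sub>jbump (x - x0)\<^sub>j\<close>, whose integral is the dimension times the integral of the bump. So all
  errors are relative to the integral of the bump and no rescaling in the radius is needed.
\<close>

lemma weak_divergence_at_differentiability_point:
  fixes X :: "'n::finite \<Rightarrow> real^'n \<Rightarrow> 'b::euclidean_space"
  assumes "has_weak_divergence_on X g \<Omega>" "open \<Omega>" "x0 \<in> \<Omega>" "isCont g x0"
    and diff: "\<And>j. X j differentiable (at x0)"
  shows "g x0 = (\<Sum>j\<in>UNIV. partial_deriv j (X j) x0)"
proof -
  obtain D where D: "\<And>j. (X j has_derivative D j) (at x0)"
    using diff unfolding differentiable_def by metis
  have bl: "bounded_linear (D j)" for j
    using D by (rule has_derivative_bounded_linear)
  define N where "N = real CARD('n)"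
  define d where "d = (\<Sum>j\<in>UNIV. D j (axis j 1))"
  \<comment> \<open>The summand 1 is the oscillation of \<open>g\<close>. One factor
    \<open>N\<close> arises because each of the \<open>N\<close> components of the gradient is
    estimated by its full length, the other from the first moment of the gradient, which is
    \<open>N\<close> times the integral of the bump.\<close>
  have bound: "norm (g x0 - d) \<le> \<eta> * (1 + N * N)" if "\<eta> > 0" for \<eta>
  proof -
    have "\<forall>\<^sub>F x in nhds x0. dist (g x) (g x0) < \<eta>"
      using assms(4) \<open>\<eta> > 0\<close> unfolding continuous_at tendsto_iff
      by (auto simp: eventually_at_filter elim!: eventually_mono)
    moreover have "\<forall>\<^sub>F x in nhds x0. \<forall>j. norm (X j x - X j x0 - D j (x - x0)) \<le> \<eta> * norm (x - x0)"
    proof (intro eventually_all_finite)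
      fix j
      obtain r where "r > 0" "\<And>x. norm (x - x0) < r \<Longrightarrow> norm (X j x - X j x0 - D j (x - x0)) \<le> \<eta> * norm (x - x0)"
        using D[of j] \<open>\<eta> > 0\<close> unfolding has_derivative_at_alt by blast
      then show "\<forall>\<^sub>F x in nhds x0. norm (X j x - X j x0 - D j (x - x0)) \<le> \<eta> * norm (x - x0)"
        unfolding eventually_nhds_metric dist_norm by blast
    qed
    moreover have "\<forall>\<^sub>F x in nhds x0. x \<in> \<Omega>"
      using assms by (simp add: eventually_nhds_in_open)
    ultimately have "\<forall>\<^sub>F x in nhds x0. dist (g x) (g x0) < \<eta> \<and>
        (\<forall>j. norm (X j x - X j x0 - D j (x - x0)) \<le> \<eta> * norm (x - x0)) \<and> x \<in> \<Omega>"
      by (intro eventually_conj)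
    then obtain r0 where r0: "r0 > 0" "\<And>x. dist x x0 < r0 \<Longrightarrow> dist (g x) (g x0) < \<eta> \<and>
        (\<forall>j. norm (X j x - X j x0 - D j (x - x0)) \<le> \<eta> * norm (x - x0)) \<and> x \<in> \<Omega>"
      unfolding eventually_nhds_metric by blast
    \<comment> \<open>The estimates hold on an open ball, but the bump is supported on a closed one;
      halving the radius fits the latter inside.\<close>
    define r where "r = r0 / 2"
    let ?K = "cball x0 r"
    have r: "r > 0" using r0 by (simp add: r_def)
    have near: "dist (g x) (g x0) < \<eta>" "norm (X j x - X j x0 - D j (x - x0)) \<le> \<eta> * norm (x - x0)" "x \<in> \<Omega>"
      if "x \<in> ?K" for x j
      using r0(2)[of x] that r0(1) by (auto simp: r_def dist_commute)
    let ?b = "bump r x0" and ?b' = "\<lambda>j x. bump' r x0 x (axis j 1)"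
    let ?R = "\<lambda>j x. X j x - X j x0 - D j (x - x0)"
    have K: "compact ?K" "?K \<subseteq> \<Omega>" using near by auto
    have ig: "set_integrable lborel ?K g" and iX: "set_integrable lborel ?K (X j)" for j
      using assms(1) K unfolding has_weak_divergence_on_def by auto
    have ibg: "integrable lborel (\<lambda>x. ?b x *\<^sub>R g x)"
      by (rule integrable_scaleR_compact_support[OF K(1) ig continuous_on_bump(1)]) (simp add: bump_eq_0 r)
    have ibX: "integrable lborel (\<lambda>x. ?b' j x *\<^sub>R X j x)" for j
      by (rule integrable_scaleR_compact_support[OF K(1) iX continuous_on_bump(2)]) (simp add: bump_eq_0 r)
    have ib': "integrable lborel (?b' j)" for j
      by (rule integrable_continuous_compact_support[OF K(1) continuous_on_bump(2)]) (simp add: bump_eq_0 r)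
    note ib = bump_integrable[OF r, of x0]
    define J where "J = (\<integral>x. ?b x \<partial>lborel)"
    have J: "J > 0" unfolding J_def by (rule bump_integral_pos[OF r])
    have "(LINT x:\<Omega>|lborel. ?b x *\<^sub>R g x) = - (LINT x:\<Omega>|lborel. (\<Sum>j\<in>UNIV. partial_deriv j ?b x *\<^sub>R X j x))"
      by (rule assms(1)[unfolded has_weak_divergence_on_def, THEN conjunct2, rule_format])
        (intro conjI exI[of _ ?K] K C2_on_bump allI impI bump_eq_0(1)[OF _ r])
    moreover have "(LINT x:\<Omega>|lborel. ?b x *\<^sub>R g x) = (\<integral>x. ?b x *\<^sub>R g x \<partial>lborel)"
      unfolding set_lebesgue_integral_def using K(2)
    proof (intro Bochner_Integration.integral_cong refl)
      fix x
      show "indicator \<Omega> x *\<^sub>R ?b x *\<^sub>R g x = ?b x *\<^sub>R g x"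
        using K(2) bump_eq_0(1)[OF _ r, of x x0] by (cases "x \<in> ?K") (auto simp: subset_iff)
    qed
    moreover have "(LINT x:\<Omega>|lborel. (\<Sum>j\<in>UNIV. partial_deriv j ?b x *\<^sub>R X j x))
        = (\<integral>x. (\<Sum>j\<in>UNIV. ?b' j x *\<^sub>R X j x) \<partial>lborel)"
      unfolding set_lebesgue_integral_def partial_deriv_eq[OF bump_has_derivative]
    proof (intro Bochner_Integration.integral_cong refl)
      fix x
      show "indicator \<Omega> x *\<^sub>R (\<Sum>j\<in>UNIV. ?b' j x *\<^sub>R X j x) = (\<Sum>j\<in>UNIV. ?b' j x *\<^sub>R X j x)"
        using K(2) bump_eq_0(2)[OF _ r, of x x0] by (cases "x \<in> ?K") (auto simp: subset_iff)
    qed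
    ultimately have weak: "(\<integral>x. ?b x *\<^sub>R g x \<partial>lborel) = - (\<Sum>j\<in>UNIV. \<integral>x. ?b' j x *\<^sub>R X j x \<partial>lborel)"
      using ibX by (simp add: Bochner_Integration.integral_sum)
    have "norm ((\<integral>x. ?b x *\<^sub>R g x \<partial>lborel) - J *\<^sub>R g x0) = norm (\<integral>x. ?b x *\<^sub>R g x - ?b x *\<^sub>R g x0 \<partial>lborel)"
      using ibg ib by (simp add: J_def)
    also have "\<dots> \<le> (\<integral>x. ?b x * \<eta> \<partial>lborel)"
    proof (rule order_trans[OF integral_norm_bound integral_mono])
      show "norm (?b x *\<^sub>R g x - ?b x *\<^sub>R g x0) \<le> ?b x * \<eta>" for x
        using near(1)[of x] bump_nonneg[of r x0 x] bump_eq_0(1)[OF _ r, of x x0]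
        by (cases "x \<in> ?K") (auto simp: scaleR_diff_right[symmetric] dist_norm intro!: mult_left_mono)
    qed (use ibg ib in auto)
    also have "\<dots> = J * \<eta>" by (simp add: J_def)
    finally have 1: "norm ((\<integral>x. ?b x *\<^sub>R g x \<partial>lborel) - J *\<^sub>R g x0) \<le> J * \<eta>" .
    \<comment> \<open>Passing from \<open>X j\<close> to its Taylor remainder changes the integral
      only by an explicit term: the constant part contributes 0 and the linear part
      \<open>- J\<close> times the diagonal derivative, whose sign flips under subtraction.\<close>
    have iR: "integrable lborel (\<lambda>x. ?b' j x *\<^sub>R ?R j x)"
      and R: "(\<integral>x. ?b' j x *\<^sub>R ?R j x \<partial>lborel) = (\<integral>x. ?b' j x *\<^sub>R X j x \<partial>lborel) + J *\<^sub>R D j (axis j 1)" for j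
    proof -
      note L = integral_bump'_linear[OF r bl[of j], of x0 "axis j 1"]
      have *: "(\<lambda>x. ?b' j x *\<^sub>R ?R j x) = (\<lambda>x. ?b' j x *\<^sub>R X j x - ?b' j x *\<^sub>R X j x0 - ?b' j x *\<^sub>R D j (x - x0))"
        by (simp add: scaleR_diff_right)
      show "integrable lborel (\<lambda>x. ?b' j x *\<^sub>R ?R j x)"
        unfolding * by (intro Bochner_Integration.integrable_diff ibX L(1) integrable_scaleR_left ib')
      show "(\<integral>x. ?b' j x *\<^sub>R ?R j x \<partial>lborel) = (\<integral>x. ?b' j x *\<^sub>R X j x \<partial>lborel) + J *\<^sub>R D j (axis j 1)"
        unfolding * using ibX[of j] L(1) ib'[of j]
        by (simp add: L(2) integral_bump'[OF r] J_def)
    qed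
    have quad: "integrable lborel (\<lambda>x. ?b' j x * (x - x0) $ j)"
      "(\<integral>x. ?b' j x * (x - x0) $ j \<partial>lborel) = - J" for j
      using integral_bump'_linear[OF r bounded_linear_vec_nth, of x0 "axis j 1" j] by (simp_all add: J_def)
    have "norm (\<Sum>j\<in>UNIV. \<integral>x. ?b' j x *\<^sub>R ?R j x \<partial>lborel) = norm (\<integral>x. (\<Sum>j\<in>UNIV. ?b' j x *\<^sub>R ?R j x) \<partial>lborel)"
      using iR by (subst Bochner_Integration.integral_sum) auto
    also have "\<dots> \<le> (\<integral>x. N * \<eta> * - (\<Sum>k\<in>UNIV. ?b' k x * (x - x0) $ k) \<partial>lborel)"
    proof (rule order_trans[OF integral_norm_bound integral_mono])
      fix x
      let ?m = "6 * max 0 (r\<^sup>2 - (x - x0) \<bullet> (x - x0)) ^ 2"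
      have b': "?b' k x = - ?m * (x - x0) $ k" for k
        by (simp add: bump'_def inner_axis)
      have sq: "- (\<Sum>k\<in>UNIV. ?b' k x * (x - x0) $ k) = ?m * (norm (x - x0) * norm (x - x0))"
        unfolding b' power2_eq_square[of "norm (x - x0)", symmetric] power2_norm_eq_inner inner_vec_def
        by (simp add: sum_distrib_left sum_negf mult.assoc)
      have "norm (?b' j x *\<^sub>R ?R j x) \<le> \<eta> * (?m * (norm (x - x0) * norm (x - x0)))" for j
      proof (cases "x \<in> ?K")
        case True
        have "norm (?b' j x *\<^sub>R ?R j x) \<le> (?m * norm (x - x0)) * (\<eta> * norm (x - x0))"
          unfolding norm_scaleR using component_le_norm_cart[of "x - x0" j] near(2)[OF True, of j]
          by (intro mult_mono) (auto simp: b' abs_mult mult_left_mono)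
        then show ?thesis by (simp add: mult_ac)
      qed (use bump_eq_0(2)[OF _ r, of x x0] \<open>\<eta> > 0\<close> in auto)
      then have "norm (\<Sum>j\<in>UNIV. ?b' j x *\<^sub>R ?R j x) \<le> (\<Sum>j\<in>(UNIV :: 'n set). \<eta> * (?m * (norm (x - x0) * norm (x - x0))))"
        by (intro sum_norm_le) auto
      then show "norm (\<Sum>j\<in>UNIV. ?b' j x *\<^sub>R ?R j x) \<le> N * \<eta> * - (\<Sum>k\<in>UNIV. ?b' k x * (x - x0) $ k)"
        unfolding sq by (simp add: N_def mult_ac)
    qed (use iR quad(1) in \<open>auto intro!: integrable_mult_right Bochner_Integration.integrable_minus Bochner_Integration.integrable_sum integrable_norm\<close>)
    also have "\<dots> = N * \<eta> * (N * J)"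
      using quad by (simp add: Bochner_Integration.integral_sum N_def del: vector_minus_component)
    finally have 2: "norm (\<Sum>j\<in>UNIV. \<integral>x. ?b' j x *\<^sub>R ?R j x \<partial>lborel) \<le> N * \<eta> * (N * J)" .
    \<comment> \<open>The weak equation replaces the flux integrals by the integral of the bump
      times \<open>g\<close>, which is already known to be close to \<open>J\<close> times
      \<open>g x0\<close>.\<close>
    have "(\<Sum>j\<in>UNIV. \<integral>x. ?b' j x *\<^sub>R ?R j x \<partial>lborel) = - (\<integral>x. ?b x *\<^sub>R g x \<partial>lborel) + J *\<^sub>R d"
      unfolding R weak by (simp add: sum.distrib d_def scaleR_sum_right)
    then have "J *\<^sub>R (d - g x0) = (\<Sum>j\<in>UNIV. \<integral>x. ?b' j x *\<^sub>R ?R j x \<partial>lborel)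
        + ((\<integral>x. ?b x *\<^sub>R g x \<partial>lborel) - J *\<^sub>R g x0)"
      by (simp add: scaleR_diff_right)
    then have "norm (J *\<^sub>R (d - g x0)) \<le> N * \<eta> * (N * J) + J * \<eta>"
      using norm_triangle_le[OF add_mono[OF 2 1]] by simp
    then have "J * norm (g x0 - d) \<le> J * (\<eta> * (1 + N * N))"
      unfolding norm_scaleR using J by (simp add: norm_minus_commute[of d] algebra_simps)
    then show ?thesis using J by simp
  qed
  have "norm (g x0 - d) \<le> 0"
  proof (rule field_le_epsilon)
    fix e :: real assume "e > 0"
    have "1 + N * N > 0" by (simp add: add_pos_nonneg N_def)
    then show "norm (g x0 - d) \<le> 0 + e"
      using bound[of "e / (1 + N * N)"] \<open>e > 0\<close> by simp
  qed
  then show ?thesis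
    by (simp add: d_def partial_deriv_eq[OF D])
qed

section \<open>Harmonic flows\<close>

text \<open>The joint derivative is restricted to the two slices through \<open>(t, x)\<close>. In
  space this gives a full derivative because \<open>\<Omega>\<close> is open; in time it stays
  within \<open>{0..T}\<close> and is one-sided at the end points.\<close>

lemma C1_on_slices:
  fixes f :: "real \<Rightarrow> 'a::euclidean_space \<Rightarrow> 'b::real_normed_vector"
  assumes "C1_on ({0..T} \<times> \<Omega>) (\<lambda>(t, x). f t x)" "open \<Omega>"
  shows "\<exists>fx ft. (\<forall>t\<in>{0..T}. \<forall>x\<in>\<Omega>. (f t has_derivative fx t x) (at x) \<and>
        ((\<lambda>s. f s x) has_vector_derivative ft t x) (at t within {0..T})) \<and>
      (\<forall>h. continuous_on ({0..T} \<times> \<Omega>) (\<lambda>z. fx (fst z) (snd z) h)) \<and>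
      continuous_on ({0..T} \<times> \<Omega>) (\<lambda>z. ft (fst z) (snd z))"
proof -
  let ?S = "{0..T} \<times> \<Omega>"
  obtain f' where f': "\<forall>z\<in>?S. ((\<lambda>(t, x). f t x) has_derivative f' z) (at z within ?S)"
    "\<forall>h. continuous_on ?S (\<lambda>z. f' z h)"
    using C1_onD[OF assms(1)] by auto
  have "(f t has_derivative (\<lambda>h. f' (t, x) (0, h))) (at x)
      \<and> ((\<lambda>s. f s x) has_vector_derivative f' (t, x) (1, 0)) (at t within {0..T})"
    if "t \<in> {0..T}" "x \<in> \<Omega>" for t x
  proof
    have tx: "((\<lambda>(t, x). f t x) has_derivative f' (t, x)) (at (t, x) within ?S)"
      using f' that by auto
    have 1: "((\<lambda>y. (t, y)) has_derivative (\<lambda>h. (0, h))) (at x within \<Omega>)"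
      by (intro derivative_intros)
    have "((\<lambda>(t, x). f t x) has_derivative f' (t, x)) (at (t, x) within (\<lambda>y. (t, y)) ` \<Omega>)"
      by (rule has_derivative_subset[OF tx]) (use that in auto)
    from has_derivative_in_compose[OF 1 this]
    show "(f t has_derivative (\<lambda>h. f' (t, x) (0, h))) (at x)"
      by (simp only: prod.case at_within_open[OF that(2) assms(2)])
    have 2: "((\<lambda>s. (s, x)) has_derivative (\<lambda>h. (h, 0))) (at t within {0..T})"
      by (intro derivative_intros)
    have "((\<lambda>(t, x). f t x) has_derivative f' (t, x)) (at (t, x) within (\<lambda>s. (s, x)) ` {0..T})"
      by (rule has_derivative_subset[OF tx]) (use that in auto)
    from has_derivative_in_compose[OF 2 this]
    have D: "((\<lambda>s. f s x) has_derivative (\<lambda>h. f' (t, x) (h, 0))) (at t within {0..T})"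
      by (simp only: prod.case)
    have eq: "f' (t, x) (h, 0) = h *\<^sub>R f' (t, x) (1, 0)" for h
      using linear_simps(5)[OF has_derivative_bounded_linear[OF tx], of h "(1, 0)"] by simp
    show "((\<lambda>s. f s x) has_vector_derivative f' (t, x) (1, 0)) (at t within {0..T})"
      unfolding has_vector_derivative_def by (rule has_derivative_eq_rhs[OF D]) (rule ext, rule eq)
  qed
  then show ?thesis
    using f'(2) by (intro exI[of _ "\<lambda>t x h. f' (t, x) (0, h)"] exI[of _ "\<lambda>t x. f' (t, x) (1, 0)"]) auto
qed

lemma jacobian_eq:
  assumes "(f has_derivative f') (at x)"
  shows "jacobian f (at x) = (\<chi> k j. f' (axis j 1) $ k)"
  using frechet_derivative_at[OF assms] by (simp add: jacobian_def matrix_def)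

text \<open>The flow at one point, as a real-linear function of the amplitude vector alone. The same
  map then applies to the partial derivatives of the amplitude and to the constant vector of a
  variation.\<close>

definition harmonic :: "real \<Rightarrow> real \<Rightarrow> complex^'n \<Rightarrow> real^'n::finite" where
  "harmonic \<omega> t z = (\<chi> k. Re (z $ k * exp (\<i> * complex_of_real (\<omega> * t))))"

lemma harmonic_flow_eq: "harmonic_flow \<omega> a t x = harmonic \<omega> t (a x)"
  by (simp add: harmonic_flow_def harmonic_def)

lemma harmonic_add: "harmonic \<omega> t (y + z) = harmonic \<omega> t y + harmonic \<omega> t z"
  and harmonic_scaleR: "harmonic \<omega> t (r *\<^sub>R z) = r *\<^sub>R harmonic \<omega> t z"
  by (simp_all add: harmonic_def vec_eq_iff algebra_simps)

lemma bounded_linear_harmonic: "bounded_linear (harmonic \<omega> t)"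
  unfolding linear_conv_bounded_linear[symmetric]
  by (rule linearI) (simp_all add: harmonic_add harmonic_scaleR)

lemma continuous_on_harmonic [continuous_intros]:
  assumes "continuous_on S f" "continuous_on S g"
  shows "continuous_on S (\<lambda>z. harmonic \<omega> (f z) (g z))"
  unfolding harmonic_def using assms by (intro continuous_intros)

lemma harmonic_flow_has_derivative:
  assumes "(a has_derivative A) (at x)"
  shows "(harmonic_flow \<omega> a t has_derivative (\<lambda>h. harmonic \<omega> t (A h))) (at x)"
  using bounded_linear.has_derivative[OF bounded_linear_harmonic assms]
  by (simp add: harmonic_flow_eq[abs_def])

text \<open>The amplitude is recovered from two times: \<open>v(0) = Re a\<close> and \<open>v(\<pi>/(2\<omega>)) = - Im a\<close>.\<close>

lemma harmonic_amplitude_C1: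
  assumes "C1_on ({0..T} \<times> \<Omega>) (\<lambda>(t, x). harmonic_flow \<omega> a t x)" "open \<Omega>"
    and "T = 2 * pi * real p / \<omega>" "T > 0"
  shows "\<exists>A. \<forall>x\<in>\<Omega>. (a has_derivative A x) (at x) \<and> (\<forall>h. continuous_on \<Omega> (\<lambda>x. A x h))"
proof -
  let ?S = "{0..T} \<times> \<Omega>"
  obtain vx where vx: "\<forall>t\<in>{0..T}. \<forall>x\<in>\<Omega>. (harmonic_flow \<omega> a t has_derivative vx t x) (at x)"
    "\<forall>h. continuous_on ?S (\<lambda>z. vx (fst z) (snd z) h)"
    using C1_on_slices[OF assms(1,2)] by blast
  \<comment> \<open>As \<open>p\<close> is a natural number, positivity of \<open>T\<close> excludes
    \<open>p = 0\<close> and forces the sign of \<open>\<omega>\<close>.\<close>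
  have \<omega>: "\<omega> > 0" and p: "p \<ge> 1"
    using assms(3,4) pi_gt_zero by (auto simp: zero_less_divide_iff zero_less_mult_iff mult_less_0_iff Suc_le_eq)
  define t1 where "t1 = pi / (2 * \<omega>)"
  \<comment> \<open>The quarter period must be an admissible time: it is at most half a period, and
    \<open>T\<close> contains \<open>p \<ge> 1\<close> full periods.\<close>
  have "t1 \<le> pi / \<omega>" using \<omega> by (simp add: t1_def field_simps)
  also have "\<dots> \<le> T" unfolding assms(3) using \<omega> p by (intro divide_right_mono) (auto simp: field_simps)
  finally have t: "0 \<in> {0..T}" "t1 \<in> {0..T}" using \<omega> \<open>T > 0\<close> by (auto simp: t1_def)
  define L :: "complex \<Rightarrow> real^'a \<Rightarrow> complex^'a" where "L c y = (\<chi> k. c * complex_of_real (y $ k))" for c y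
  have L: "bounded_linear (L c)" for c
    unfolding linear_conv_bounded_linear[symmetric]
    by (rule linearI) (simp_all add: L_def vec_eq_iff algebra_simps complex_eq_iff)
  have "\<omega> * t1 = pi / 2" using \<omega> by (simp add: t1_def)
  then have "exp (\<i> * complex_of_real (\<omega> * t1)) = \<i>"
    by (metis cis_conv_exp cis_pi_half)
  \<comment> \<open>At \<open>t1\<close> the flow is minus the imaginary part of \<open>a\<close>,
    so multiplying it by \<open>- \<i>\<close> restores the imaginary contribution with the right
    sign.\<close>
  then have a: "a = (\<lambda>x. L 1 (harmonic_flow \<omega> a 0 x) + L (- \<i>) (harmonic_flow \<omega> a t1 x))"
    by (auto simp: fun_eq_iff vec_eq_iff L_def harmonic_flow_def complex_eq_iff)
  have "(a has_derivative (\<lambda>h. L 1 (vx 0 x h) + L (- \<i>) (vx t1 x h))) (at x)" if "x \<in> \<Omega>" for x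
    using t that vx(1)
    by (subst a) (intro has_derivative_add bounded_linear.has_derivative[OF L]; blast)
  moreover have "continuous_on \<Omega> (\<lambda>x. vx t x h)" if "t \<in> {0..T}" for t h
  proof -
    have "continuous_on \<Omega> ((\<lambda>z. vx (fst z) (snd z) h) \<circ> (\<lambda>x. (t, x)))"
      by (rule continuous_on_compose) (use that vx(2)[rule_format, of h] in \<open>auto intro!: continuous_intros elim!: continuous_on_subset\<close>)
    then show ?thesis by (simp add: o_def)
  qed
  then have "continuous_on \<Omega> (\<lambda>x. L 1 (vx 0 x h) + L (- \<i>) (vx t1 x h))" for h
    using t by (intro continuous_intros bounded_linear.continuous_on[OF L])
  ultimately show ?thesis
    by (intro exI[of _ "\<lambda>x h. L 1 (vx 0 x h) + L (- \<i>) (vx t1 x h)"]) blast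
qed

text \<open>Makes the variations admissible. Splitting the exponential into cosine and sine leaves
  products of C2 functions of \<open>t\<close> alone, of \<open>x\<close> alone, and constant
  vectors.\<close>

lemma C2_on_harmonic_flow_separated:
  fixes \<phi> :: "real^'n::finite \<Rightarrow> real"
  assumes "C2_on UNIV \<phi>"
  shows "C2_on S (\<lambda>(t, x). harmonic_flow \<omega> (\<lambda>x. \<phi> x *\<^sub>R c) t x)"
proof -
  have \<phi>: "C2_on S (\<lambda>z :: real \<times> (real^'n). \<phi> (snd z))"
    by (rule C2_on_compose_bounded_linear[OF bounded_linear_snd assms])
  have "bounded_linear (\<lambda>z :: real \<times> (real^'n). \<omega> * fst z)"
    by (intro bounded_linear_intros)
  from C2_on_bounded_linear_affine[OF this, of S 0 0]
  have \<omega>: "C2_on S (\<lambda>z :: real \<times> (real^'n). \<omega> * fst z)" by simp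
  have cos: "C2_on S (\<lambda>z :: real \<times> (real^'n). cos (\<omega> * fst z))"
    by (rule C2_on_chain_real[OF DERIV_cos DERIV_minus[OF DERIV_sin] _ \<omega>]) (intro continuous_intros)
  have sin: "C2_on S (\<lambda>z :: real \<times> (real^'n). sin (\<omega> * fst z))"
    by (rule C2_on_chain_real[OF DERIV_sin DERIV_cos _ \<omega>]) (intro continuous_intros)
  have const: "C2_on S (\<lambda>z. d)" for d :: "real^'n"
    using C2_on_bounded_linear_affine[OF bounded_linear_zero, of S d] by simp
  have "C2_on S (\<lambda>z :: real \<times> (real^'n). cos (\<omega> * fst z) *\<^sub>R (\<phi> (snd z) *\<^sub>R (\<chi> k. Re (c $ k)))
     + sin (\<omega> * fst z) *\<^sub>R (\<phi> (snd z) *\<^sub>R (\<chi> k. - Im (c $ k))))"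
    by (intro C2_on_add C2_on_scaleR cos sin \<phi> const)
  moreover have "(\<lambda>(t, x). harmonic_flow \<omega> (\<lambda>x. \<phi> x *\<^sub>R c) t x) = (\<lambda>z :: real \<times> (real^'n). cos (\<omega> * fst z) *\<^sub>R (\<phi> (snd z) *\<^sub>R (\<chi> k. Re (c $ k)))
     + sin (\<omega> * fst z) *\<^sub>R (\<phi> (snd z) *\<^sub>R (\<chi> k. - Im (c $ k))))"
    unfolding harmonic_flow_def cis_conv_exp[symmetric]
    by (auto simp: fun_eq_iff vec_eq_iff algebra_simps)
  ultimately show ?thesis by simp
qed

section \<open>Time integrals depending on \<open>x\<close>, and comparison of energies on a compact
  set\<close>

lemma continuous_on_slice:
  assumes "continuous_on (A \<times> B) (\<lambda>z. f (fst z) (snd z))" "y \<in> B"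
  shows "continuous_on A (\<lambda>t. f t y)"
proof -
  have "continuous_on A ((\<lambda>z. f (fst z) (snd z)) \<circ> (\<lambda>t. (t, y)))"
    by (rule continuous_on_compose) (use assms in \<open>auto intro!: continuous_intros elim!: continuous_on_subset\<close>)
  then show ?thesis by (simp add: o_def)
qed

lemma continuous_on_integral_slice:
  fixes f :: "real \<Rightarrow> 'a::topological_space \<Rightarrow> 'b::banach"
  assumes "continuous_on ({0..T} \<times> \<Omega>) (\<lambda>z. f (fst z) (snd z))"
  shows "continuous_on \<Omega> (\<lambda>x. integral {0..T} (\<lambda>t. f t x))"
proof -
  have "continuous_on (\<Omega> \<times> cbox 0 T) ((\<lambda>z. f (fst z) (snd z)) \<circ> prod.swap)"
    by (intro continuous_on_compose continuous_on_swap) (use assms in \<open>simp add: product_swap\<close>)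
  then have "continuous_on (\<Omega> \<times> cbox 0 T) (\<lambda>(x, t). f t x)"
    by (simp add: o_def split_beta)
  from integral_continuous_on_param[OF this] show ?thesis by simp
qed

text \<open>Meant for the densities of the minimizer and of a competitor that differs from it only
  on \<open>K\<close>. Finiteness is asked of \<open>e0\<close> alone: outside \<open>K\<close> the
  two integrals coincide, and over \<open>K\<close> both are finite by continuity and
  compactness.\<close>

lemma nn_integral_mono_on_compact:
  fixes e0 e1 :: "real \<Rightarrow> 'a::euclidean_space \<Rightarrow> real"
  assumes \<Omega>: "open \<Omega>" and K: "compact K" "K \<subseteq> \<Omega>"
    and cont: "continuous_on ({0..T} \<times> \<Omega>) (\<lambda>z. e0 (fst z) (snd z))" "continuous_on ({0..T} \<times> \<Omega>) (\<lambda>z. e1 (fst z) (snd z))"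
    and nonneg: "\<And>t x. t \<in> {0..T} \<Longrightarrow> x \<in> \<Omega> \<Longrightarrow> 0 \<le> e0 t x" "\<And>t x. t \<in> {0..T} \<Longrightarrow> x \<in> \<Omega> \<Longrightarrow> 0 \<le> e1 t x"
    and eq: "\<And>t x. t \<in> {0..T} \<Longrightarrow> x \<in> \<Omega> - K \<Longrightarrow> e0 t x = e1 t x"
    and le: "(\<integral>\<^sup>+x\<in>\<Omega>. (\<integral>\<^sup>+t\<in>{0..T}. ennreal (e0 t x) \<partial>lborel) \<partial>lborel)
      \<le> (\<integral>\<^sup>+x\<in>\<Omega>. (\<integral>\<^sup>+t\<in>{0..T}. ennreal (e1 t x) \<partial>lborel) \<partial>lborel)"
    and fin: "(\<integral>\<^sup>+x\<in>\<Omega>. (\<integral>\<^sup>+t\<in>{0..T}. ennreal (e0 t x) \<partial>lborel) \<partial>lborel) < \<infinity>"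
  shows "(LINT x:K|lborel. integral {0..T} (\<lambda>t. e0 t x)) \<le> (LINT x:K|lborel. integral {0..T} (\<lambda>t. e1 t x))"
proof -
  \<comment> \<open>Replaces the inner extended integral by a real one that is continuous in
    \<open>x\<close>, hence integrable over \<open>K\<close>.\<close>
  have main: "continuous_on \<Omega> (\<lambda>x. integral {0..T} (\<lambda>t. e t x)) \<and> (\<forall>x\<in>\<Omega>. 0 \<le> integral {0..T} (\<lambda>t. e t x)) \<and>
      (\<forall>x\<in>\<Omega>. (\<integral>\<^sup>+t\<in>{0..T}. ennreal (e t x) \<partial>lborel) = ennreal (integral {0..T} (\<lambda>t. e t x)))"
    if c: "continuous_on ({0..T} \<times> \<Omega>) (\<lambda>z. e (fst z) (snd z))"
      and n: "\<And>t x. t \<in> {0..T} \<Longrightarrow> x \<in> \<Omega> \<Longrightarrow> 0 \<le> e t x" for e :: "real \<Rightarrow> 'a \<Rightarrow> real"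
  proof (intro conjI ballI)
    show "continuous_on \<Omega> (\<lambda>x. integral {0..T} (\<lambda>t. e t x))"
      by (rule continuous_on_integral_slice[OF c])
    fix x assume x: "x \<in> \<Omega>"
    from borel_integrable_atLeastAtMost'[OF continuous_on_slice[OF c x]]
    have i: "set_integrable lborel {0..T} (\<lambda>t. e t x)" .
    show "0 \<le> integral {0..T} (\<lambda>t. e t x)"
      using n x set_borel_integral_eq_integral(1)[OF i] by (intro integral_nonneg) auto
    have "(\<integral>\<^sup>+t\<in>{0..T}. ennreal (e t x) \<partial>lborel) = (\<integral>\<^sup>+t. ennreal (indicator {0..T} t *\<^sub>R e t x) \<partial>lborel)"
      by (intro nn_integral_cong) (auto simp: indicator_def)
    also have "\<dots> = ennreal (LINT t:{0..T}|lborel. e t x)"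
      unfolding set_lebesgue_integral_def using i n x
      by (intro nn_integral_eq_integral) (auto simp: set_integrable_def indicator_def)
    finally show "(\<integral>\<^sup>+t\<in>{0..T}. ennreal (e t x) \<partial>lborel) = ennreal (integral {0..T} (\<lambda>t. e t x))"
      by (simp add: set_borel_integral_eq_integral(2)[OF i])
  qed
  have split: "(\<integral>\<^sup>+x\<in>\<Omega>. (\<integral>\<^sup>+t\<in>{0..T}. ennreal (e t x) \<partial>lborel) \<partial>lborel)
      = (\<integral>\<^sup>+x\<in>\<Omega> - K. ennreal (integral {0..T} (\<lambda>t. e t x)) \<partial>lborel) + ennreal (LINT x:K|lborel. integral {0..T} (\<lambda>t. e t x))
      \<and> 0 \<le> (LINT x:K|lborel. integral {0..T} (\<lambda>t. e t x))"
    if c: "continuous_on ({0..T} \<times> \<Omega>) (\<lambda>z. e (fst z) (snd z))"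
      and n: "\<And>t x. t \<in> {0..T} \<Longrightarrow> x \<in> \<Omega> \<Longrightarrow> 0 \<le> e t x" for e :: "real \<Rightarrow> 'a \<Rightarrow> real"
  proof
    let ?P = "\<lambda>x. integral {0..T} (\<lambda>t. e t x)"
    have P: "continuous_on \<Omega> ?P" "\<And>x. x \<in> \<Omega> \<Longrightarrow> 0 \<le> ?P x"
      "\<And>x. x \<in> \<Omega> \<Longrightarrow> (\<integral>\<^sup>+t\<in>{0..T}. ennreal (e t x) \<partial>lborel) = ennreal (?P x)"
      using main[OF c n] by auto
    have m: "(\<lambda>x. ennreal (?P x) * indicator A x) \<in> borel_measurable lborel" if "A \<in> sets borel" "A \<subseteq> \<Omega>" for A
    proof -
      have "(\<lambda>x. ennreal (indicator A x *\<^sub>R ?P x)) \<in> borel_measurable borel"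
        using borel_measurable_continuous_on_indicator[OF that(1) continuous_on_subset[OF P(1) that(2)]] by measurable
      moreover have "(\<lambda>x. ennreal (indicator A x *\<^sub>R ?P x)) = (\<lambda>x. ennreal (?P x) * indicator A x)"
        by (auto simp: indicator_def)
      ultimately show ?thesis by simp
    qed
    have bor: "K \<in> sets borel" "\<Omega> - K \<in> sets borel"
      using \<Omega> K by (auto intro: borel_compact)
    have "(\<integral>\<^sup>+x\<in>\<Omega>. (\<integral>\<^sup>+t\<in>{0..T}. ennreal (e t x) \<partial>lborel) \<partial>lborel)
      = (\<integral>\<^sup>+x. ennreal (?P x) * indicator (\<Omega> - K) x + ennreal (?P x) * indicator K x \<partial>lborel)"
    proof (intro nn_integral_cong)
      fix x
      show "(\<integral>\<^sup>+t\<in>{0..T}. ennreal (e t x) \<partial>lborel) * indicator \<Omega> x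
          = ennreal (?P x) * indicator (\<Omega> - K) x + ennreal (?P x) * indicator K x"
        using K(2) P(3)[of x] by (cases "x \<in> \<Omega>"; cases "x \<in> K") auto
    qed
    also have "\<dots> = (\<integral>\<^sup>+x\<in>\<Omega> - K. ennreal (?P x) \<partial>lborel) + (\<integral>\<^sup>+x\<in>K. ennreal (?P x) \<partial>lborel)"
      by (rule nn_integral_add) (use m bor K(2) in auto)
    also have "(\<integral>\<^sup>+x\<in>K. ennreal (?P x) \<partial>lborel) = (\<integral>\<^sup>+x. ennreal (indicator K x *\<^sub>R ?P x) \<partial>lborel)"
      by (intro nn_integral_cong) (auto simp: indicator_def)
    also have "\<dots> = ennreal (LINT x:K|lborel. ?P x)"
      unfolding set_lebesgue_integral_def using K(2)
      by (intro nn_integral_eq_integral borel_integrable_compact K(1) continuous_on_subset[OF P(1)])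
        (auto simp: indicator_def P(2) subset_iff)
    finally show "(\<integral>\<^sup>+x\<in>\<Omega>. (\<integral>\<^sup>+t\<in>{0..T}. ennreal (e t x) \<partial>lborel) \<partial>lborel)
      = (\<integral>\<^sup>+x\<in>\<Omega> - K. ennreal (?P x) \<partial>lborel) + ennreal (LINT x:K|lborel. ?P x)" .
    show "0 \<le> (LINT x:K|lborel. ?P x)"
      unfolding set_lebesgue_integral_def using P(2) K(2)
      by (intro Bochner_Integration.integral_nonneg) (auto simp: indicator_def)
  qed
  have "(\<integral>\<^sup>+x\<in>\<Omega> - K. ennreal (integral {0..T} (\<lambda>t. e0 t x)) \<partial>lborel)
      = (\<integral>\<^sup>+x\<in>\<Omega> - K. ennreal (integral {0..T} (\<lambda>t. e1 t x)) \<partial>lborel)"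
  proof (intro nn_integral_cong)
    fix x
    have "integral {0..T} (\<lambda>t. e0 t x) = integral {0..T} (\<lambda>t. e1 t x)" if "x \<in> \<Omega> - K"
      using that eq by (intro Henstock_Kurzweil_Integration.integral_cong) auto
    then show "ennreal (integral {0..T} (\<lambda>t. e0 t x)) * indicator (\<Omega> - K) x
       = ennreal (integral {0..T} (\<lambda>t. e1 t x)) * indicator (\<Omega> - K) x"
      by (cases "x \<in> \<Omega> - K") auto
  qed
  \<comment> \<open>The part outside \<open>K\<close> is bounded by the finite total of
    \<open>e0\<close>, so it may be cancelled on both sides.\<close>
  with le fin show ?thesis
    using split[OF cont(1) nonneg(1)] split[OF cont(2) nonneg(2)]
    by (auto simp: ennreal_add_left_cancel_le ennreal_le_iff less_top)
qed

lemma quadratic_nonneg_imp_linear_coeff_0: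
  fixes l m :: real
  assumes "\<And>s. 0 \<le> s * l + s\<^sup>2 * m"
  shows "l = 0"
proof (rule ccontr)
  assume "l \<noteq> 0"
  \<comment> \<open>Any \<open>k\<close> that is positive and larger than \<open>m\<close> works: at
    \<open>s = - l / k\<close> the polynomial equals \<open>- l^2 (k - m) / k^2\<close>, which is
    negative for \<open>l\<close> nonzero.\<close>
  define k where "k = 1 + \<bar>m\<bar>"
  define s where "s = - l / k"
  have k: "k > 0" "m < k" by (auto simp: k_def)
  then have sk: "s * k = - l" by (simp add: s_def)
  have "(s * l + s\<^sup>2 * m) * k\<^sup>2 = (s * k) * k * l + (s * k)\<^sup>2 * m"
    by (simp add: power2_eq_square algebra_simps)
  also have "\<dots> = - (l\<^sup>2 * (k - m))"
    unfolding sk by (simp add: power2_eq_square algebra_simps)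
  also have "\<dots> < 0"
    using \<open>l \<noteq> 0\<close> k by simp
  finally have "(s * l + s\<^sup>2 * m) * k\<^sup>2 < 0" .
  moreover have "0 \<le> (s * l + s\<^sup>2 * m) * k\<^sup>2"
    using assms[of s] by simp
  ultimately show False by simp
qed

section \<open>First variation of the energy\<close>

lemma fourier_has_integral:
  assumes "continuous_on {0..T} (\<lambda>t. f t x)"
  shows "((\<lambda>t. complex_of_real (f t x) * exp (- (\<i> * complex_of_real (t * \<nu>)))) has_integral fourier T f \<nu> x) {0..T}"
proof -
  have "set_integrable lborel {0..T} (\<lambda>t. complex_of_real (f t x) * exp (- (\<i> * complex_of_real (t * \<nu>))))"
    by (intro borel_integrable_atLeastAtMost' continuous_intros assms)
  note i = set_borel_integral_eq_integral[OF this]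
  show ?thesis
    unfolding fourier_def i(2) by (rule integrable_integral[OF i(1)])
qed

lemma exp_minus_i_mult_eq_cnj_cis: "exp (- (\<i> * complex_of_real (t * \<omega>))) = cnj (cis (\<omega> * t))"
  by (simp add: cis_conv_exp exp_cnj mult.commute)

text \<open>Factoring out the exponential at frequency \<open>\<omega>\<close> leaves a number plus
  its conjugate. Under the integral this merges the coefficients at 0 and
  \<open>2 * \<omega>\<close>, acting on an amplitude and on its conjugate, into one coefficient at
  \<open>\<omega>\<close> of the real flow.\<close>

lemma demodulation:
  "z + cnj z * exp (- (\<i> * complex_of_real (t * (2 * \<omega>))))
    = 2 * complex_of_real (Re (z * exp (\<i> * complex_of_real (\<omega> * t)))) * exp (- (\<i> * complex_of_real (t * \<omega>)))"
proof -
  let ?E = "cis (\<omega> * t)"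
  have "exp (- (\<i> * complex_of_real (t * (2 * \<omega>)))) = cis (- (t * (2 * \<omega>)))"
    by (simp only: cis_conv_exp of_real_minus mult_minus_right)
  also have "\<dots> = cnj ?E * cnj ?E"
    by (simp add: cis_cnj cis_mult algebra_simps)
  finally have 2: "exp (- (\<i> * complex_of_real (t * (2 * \<omega>)))) = cnj ?E * cnj ?E" .
  have "2 * complex_of_real (Re (z * ?E)) * cnj ?E = (z * ?E + cnj z * cnj ?E) * cnj ?E"
    using complex_add_cnj[of "z * ?E"] by (simp del: times_complex.sel)
  also have "\<dots> = z * (?E * cnj ?E) + cnj z * (cnj ?E * cnj ?E)"
    by (simp only: ring_distribs mult.assoc)
  also have "?E * cnj ?E = 1" by (simp add: cis_cnj cis_mult)
  finally show ?thesis
    unfolding exp_minus_i_mult_eq_cnj_cis[of t \<omega>] 2 cis_conv_exp[symmetric] by simp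
qed

text \<open>The real inner product of \<open>c\<close> and \<open>z\<close> is the real part of
  \<open>c\<close> times the conjugate of \<open>z\<close>, and conjugation reverses the sign of the
  frequency. Pairing with \<open>c\<close> therefore creates the variation with amplitude
  \<open>c\<close>.\<close>

lemma inner_demodulated:
  "c \<bullet> (complex_of_real r * exp (- (\<i> * complex_of_real (t * \<omega>)))) = r * Re (c * exp (\<i> * complex_of_real (\<omega> * t)))"
  unfolding exp_minus_i_mult_eq_cnj_cis cis_conv_exp[symmetric] by (simp add: inner_complex_def algebra_simps)

text \<open>With \<open>z\<close> frozen this is a quadratic in \<open>x\<close> whose coefficient
  is half of the weight.\<close>

lemma q_eq: "q \<epsilon> x z = 1 / 2 * (1 / max \<epsilon> \<bar>z\<bar>) * x\<^sup>2 + 1 / 2 * max \<epsilon> \<bar>z\<bar>"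
  by (simp add: q_def)

lemma jacobian_harmonic_flow:
  assumes "(a has_derivative A) (at x)"
  shows "jacobian (harmonic_flow \<omega> a t) (at x) = (\<chi> k j. harmonic \<omega> t (partial_deriv j a x) $ k)"
  by (simp add: jacobian_eq[OF harmonic_flow_has_derivative[OF assms]] partial_deriv_eq[OF assms])

text \<open>The Frobenius product is summed by spatial direction rather than by component, to match
  the index \<open>j\<close> of the flux.\<close>

lemma inner_jacobian_harmonic_flow:
  assumes "(a has_derivative A) (at x)" "(b has_derivative B) (at x)"
  shows "jacobian (harmonic_flow \<omega> a t) (at x) \<bullet> jacobian (harmonic_flow \<omega> b t) (at x)
    = (\<Sum>j\<in>UNIV. harmonic \<omega> t (partial_deriv j a x) \<bullet> harmonic \<omega> t (partial_deriv j b x))"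
  unfolding jacobian_harmonic_flow[OF assms(1)] jacobian_harmonic_flow[OF assms(2)] inner_vec_def
  by (subst sum.swap) simp

text \<open>The derivative \<open>A\<close> of the amplitude is a parameter, supplied later by
  \<open>harmonic_amplitude_C1\<close>. Minimality is left out, because the representation of data
  term and flux by time integrals and the expansion of the density hold for every such
  amplitude.\<close>

locale flow_problem =
  fixes \<Omega> :: "(real^'n::finite) set" and \<omega> T lam \<epsilon> \<delta> :: real
    and I :: "real \<Rightarrow> real^'n \<Rightarrow> real" and u :: "real \<Rightarrow> real^'n \<Rightarrow> real^'n"
    and a :: "real^'n \<Rightarrow> complex^'n" and A :: "real^'n \<Rightarrow> real^'n \<Rightarrow> complex^'n"
  assumes open_dom: "open \<Omega>" and T_pos: "T > 0" and lam_pos: "lam > 0" and eps_pos: "\<epsilon> > 0" "\<delta> > 0"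
    and C1_I: "C1_on ({0..T} \<times> \<Omega>) (\<lambda>(t, x). I t x)"
    and C1_u: "C1_on ({0..T} \<times> \<Omega>) (\<lambda>(t, x). u t x)"
    and a_deriv: "\<And>x. x \<in> \<Omega> \<Longrightarrow> (a has_derivative A x) (at x)"
    and A_cont: "\<And>h. continuous_on \<Omega> (\<lambda>x. A x h)"
begin

abbreviation "S \<equiv> {0..T} \<times> \<Omega>"
abbreviation "wD \<equiv> data_weight T \<epsilon> I u"
abbreviation "wR \<equiv> reg_weight \<delta> u"
abbreviation "G \<equiv> flow_residual T I (harmonic_flow \<omega> a)"
abbreviation "D \<equiv> data_term T \<omega> \<epsilon> I u a"
abbreviation "R \<equiv> reg_flux T \<omega> \<delta> u a"

section \<open>Continuity of the data, the weights, the data term and the flux\<close>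

lemma continuous_on_snd_comp: "continuous_on \<Omega> f \<Longrightarrow> continuous_on S (\<lambda>z. f (snd z))"
  by (erule continuous_on_compose2) (auto intro: continuous_intros)

lemma continuous_on_grad [continuous_intros]: "continuous_on S (\<lambda>z. grad (I (fst z)) (snd z))"
  and continuous_on_time_deriv [continuous_intros]: "continuous_on S (\<lambda>z. time_deriv T I (fst z) (snd z))"
proof -
  obtain fx ft where f: "\<forall>t\<in>{0..T}. \<forall>x\<in>\<Omega>. (I t has_derivative fx t x) (at x) \<and>
        ((\<lambda>s. I s x) has_vector_derivative ft t x) (at t within {0..T})"
      and fx: "\<forall>h. continuous_on S (\<lambda>z. fx (fst z) (snd z) h)"
      and ft: "continuous_on S (\<lambda>z. ft (fst z) (snd z))"
    using C1_on_slices[OF C1_I open_dom] by blast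
  have "continuous_on S (\<lambda>z. \<chi> j. fx (fst z) (snd z) (axis j 1))"
    using fx by (intro continuous_intros) auto
  then show "continuous_on S (\<lambda>z. grad (I (fst z)) (snd z))"
    by (rule continuous_on_eq) (use f in \<open>auto simp: grad_def vec_eq_iff intro!: partial_deriv_eq[symmetric]\<close>)
  show "continuous_on S (\<lambda>z. time_deriv T I (fst z) (snd z))"
    \<comment> \<open>\<open>T > 0\<close> makes the derivative within \<open>{0..T}\<close> unique,
      including at the end points, so \<open>time_deriv\<close> is the derivative obtained from the
      slice.\<close>
    by (rule continuous_on_eq[OF ft])
      (use f T_pos in \<open>auto simp: time_deriv_def intro!: vector_derivative_within_closed_interval[symmetric]\<close>)
qed

lemma continuous_on_u [continuous_intros]: "continuous_on S (\<lambda>z. u (fst z) (snd z))"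
  using C1_on_imp_continuous_on[OF C1_u] by (simp add: split_beta)

lemma continuous_on_jacobian_u [continuous_intros]: "continuous_on S (\<lambda>z. jacobian (u (fst z)) (at (snd z)))"
proof -
  obtain fx where f: "\<forall>t\<in>{0..T}. \<forall>x\<in>\<Omega>. (u t has_derivative fx t x) (at x)"
      and fx: "\<forall>h. continuous_on S (\<lambda>z. fx (fst z) (snd z) h)"
    using C1_on_slices[OF C1_u open_dom] by blast
  have "continuous_on S (\<lambda>z. \<chi> k j. fx (fst z) (snd z) (axis j 1) $ k)"
    using fx by (intro continuous_intros) auto
  then show ?thesis
    by (rule continuous_on_eq) (use f in \<open>auto intro!: jacobian_eq[symmetric]\<close>)
qed

lemma continuous_on_weights [continuous_intros]:
  "continuous_on S (\<lambda>z. wD (fst z) (snd z))" "continuous_on S (\<lambda>z. wR (fst z) (snd z))"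
proof -
  have "max \<epsilon> y \<noteq> 0" "max \<delta> y \<noteq> 0" for y
    using eps_pos by (auto simp: max_def)
  then show "continuous_on S (\<lambda>z. wD (fst z) (snd z))" "continuous_on S (\<lambda>z. wR (fst z) (snd z))"
    unfolding data_weight_def reg_weight_def flow_residual_def
    by (intro continuous_intros; simp)+
qed

lemma partial_deriv_a: "x \<in> \<Omega> \<Longrightarrow> partial_deriv j a x = A x (axis j 1)"
  by (rule partial_deriv_eq[OF a_deriv])

lemma continuous_on_a: "continuous_on \<Omega> a"
  by (intro continuous_at_imp_continuous_on ballI has_derivative_continuous[OF a_deriv])

lemma continuous_on_partial_a: "continuous_on \<Omega> (partial_deriv j a)"
  by (rule continuous_on_eq[OF A_cont[of "axis j 1"]]) (simp add: partial_deriv_a)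

lemmas continuous_on_a_snd [continuous_intros] =
  continuous_on_snd_comp[OF continuous_on_a] continuous_on_snd_comp[OF continuous_on_partial_a]

lemma continuous_on_G [continuous_intros]: "continuous_on S (\<lambda>z. G (fst z) (snd z))"
  unfolding flow_residual_def harmonic_flow_eq by (intro continuous_intros)

lemma continuous_on_data_density:
  "continuous_on S (\<lambda>z. 2 * (wD (fst z) (snd z) * G (fst z) (snd z) * (grad (I (fst z)) (snd z) \<bullet> harmonic \<omega> (fst z) c)))"
  by (intro continuous_intros)

lemma continuous_on_flux_density:
  "continuous_on S (\<lambda>z. 2 * (wR (fst z) (snd z) * (harmonic \<omega> (fst z) (partial_deriv j a (snd z)) \<bullet> harmonic \<omega> (fst z) c)))"
  by (intro continuous_intros)

text \<open>Under the integral the two matrix terms combine by \<open>demodulation\<close> into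
  twice the weight times the gradient times its product with the flow, at frequency
  \<open>\<omega>\<close>. The remaining vector term adds the time derivative, which completes the
  flow residual \<open>G\<close>.\<close>

lemma inner_data_term:
  assumes "x \<in> \<Omega>"
  shows "((\<lambda>t. 2 * (wD t x * G t x * (grad (I t) x \<bullet> harmonic \<omega> t c))) has_integral (c \<bullet> D x)) {0..T}"
proof -
  note sl = continuous_on_slice[where B = \<Omega>, OF _ assms]
  let ?F = "\<lambda>t. exp (- (\<i> * complex_of_real (t * \<omega>)))"
  let ?M = "\<lambda>t y. wD t y *\<^sub>R outer (grad (I t) y) (grad (I t) y)"
  let ?b = "\<lambda>t y. (wD t y * time_deriv T I t y) *\<^sub>R grad (I t) y"
  have cM: "continuous_on {0..T} (\<lambda>t. ?M t x $ k $ j)" for k j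
    unfolding outer_def by (rule sl) (simp, intro continuous_intros)
  have cb: "continuous_on {0..T} (\<lambda>t. ?b t x $ k)" for k
    by (rule sl) (intro continuous_intros)
  have "((\<lambda>t. 2 * complex_of_real (wD t x * G t x * grad (I t) x $ k) * ?F t) has_integral (D x $ k)) {0..T}" for k
  proof -
    \<comment> \<open>Component \<open>k\<close> of the data term with the matrix products expanded,
      so that all three coefficients stand under one integral before they are combined.\<close>
    have "((\<lambda>t. (\<Sum>j\<in>UNIV. (complex_of_real (?M t x $ k $ j) * exp (- (\<i> * complex_of_real (t * 0)))) * a x $ j)
        + (\<Sum>j\<in>UNIV. (complex_of_real (?M t x $ k $ j) * exp (- (\<i> * complex_of_real (t * (2 * \<omega>))))) * cnj (a x $ j))
        + 2 *\<^sub>R (complex_of_real (?b t x $ k) * ?F t)) has_integral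
       ((\<Sum>j\<in>UNIV. fourier T (\<lambda>t y. ?M t y $ k $ j) 0 x * a x $ j)
        + (\<Sum>j\<in>UNIV. fourier T (\<lambda>t y. ?M t y $ k $ j) (2 * \<omega>) x * cnj (a x $ j))
        + 2 *\<^sub>R fourier T (\<lambda>t y. ?b t y $ k) \<omega> x)) {0..T}"
      by (intro has_integral_add has_integral_sum has_integral_mult_left has_integral_cmul
          fourier_has_integral cM cb) auto
    also have "(\<Sum>j\<in>UNIV. fourier T (\<lambda>t y. ?M t y $ k $ j) 0 x * a x $ j)
        + (\<Sum>j\<in>UNIV. fourier T (\<lambda>t y. ?M t y $ k $ j) (2 * \<omega>) x * cnj (a x $ j))
        + 2 *\<^sub>R fourier T (\<lambda>t y. ?b t y $ k) \<omega> x = D x $ k"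
      by (simp only: data_term_def fourier_mat_def fourier_vec_def matrix_vector_mult_def conj_vec_def
          vec_lambda_beta vector_add_component vector_scaleR_component)
    finally show ?thesis
    proof (rule has_integral_eq[rotated])
      fix t
      have h: "Re (a x $ j * exp (\<i> * complex_of_real (\<omega> * t))) = harmonic_flow \<omega> a t x $ j" for j
        by (simp add: harmonic_flow_def)
      let ?m = "\<lambda>j. wD t x * (grad (I t) x $ k * grad (I t) x $ j)"
      have "(\<Sum>j\<in>UNIV. (complex_of_real (?M t x $ k $ j) * exp (- (\<i> * complex_of_real (t * 0)))) * a x $ j)
        + (\<Sum>j\<in>UNIV. (complex_of_real (?M t x $ k $ j) * exp (- (\<i> * complex_of_real (t * (2 * \<omega>))))) * cnj (a x $ j))
        = (\<Sum>j\<in>UNIV. complex_of_real (?m j) * (a x $ j + cnj (a x $ j) * exp (- (\<i> * complex_of_real (t * (2 * \<omega>))))))"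
        by (simp add: sum.distrib[symmetric] outer_def algebra_simps)
      also have "\<dots> = (\<Sum>j\<in>UNIV. complex_of_real (2 * (?m j * harmonic_flow \<omega> a t x $ j)) * ?F t)"
        unfolding demodulation h by (simp add: mult_ac)
      also have "\<dots> = complex_of_real (2 * (wD t x * grad (I t) x $ k * (grad (I t) x \<bullet> harmonic_flow \<omega> a t x))) * ?F t"
        by (simp add: inner_vec_def sum_distrib_left sum_distrib_right mult_ac)
      finally have eq: "(\<Sum>j\<in>UNIV. (complex_of_real (?M t x $ k $ j) * exp (- (\<i> * complex_of_real (t * 0)))) * a x $ j)
        + (\<Sum>j\<in>UNIV. (complex_of_real (?M t x $ k $ j) * exp (- (\<i> * complex_of_real (t * (2 * \<omega>))))) * cnj (a x $ j))
        = complex_of_real (2 * (wD t x * grad (I t) x $ k * (grad (I t) x \<bullet> harmonic_flow \<omega> a t x))) * ?F t" .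
      show "(\<Sum>j\<in>UNIV. (complex_of_real (?M t x $ k $ j) * exp (- (\<i> * complex_of_real (t * 0)))) * a x $ j)
        + (\<Sum>j\<in>UNIV. (complex_of_real (?M t x $ k $ j) * exp (- (\<i> * complex_of_real (t * (2 * \<omega>))))) * cnj (a x $ j))
        + 2 *\<^sub>R (complex_of_real (?b t x $ k) * ?F t)
        = 2 * complex_of_real (wD t x * G t x * grad (I t) x $ k) * ?F t"
        unfolding eq by (simp add: flow_residual_def algebra_simps scaleR_2)
    qed
  qed
  then have int: "((\<lambda>t. \<Sum>k\<in>UNIV. c $ k \<bullet> (2 * complex_of_real (wD t x * G t x * grad (I t) x $ k) * ?F t)) has_integral
      (\<Sum>k\<in>UNIV. c $ k \<bullet> D x $ k)) {0..T}"
    by (intro has_integral_sum has_integral_linear[OF _ bounded_linear_inner_right, unfolded o_def]) auto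
  have "c $ k \<bullet> (2 * complex_of_real r * ?F t) = 2 * r * harmonic \<omega> t c $ k" for k r t
    using inner_demodulated[of "c $ k" "2 * r" t \<omega>] by (simp add: harmonic_def)
  from int[unfolded this] show ?thesis
    by (simp add: inner_vec_def sum_distrib_left mult_ac)
qed

text \<open>The same computation with a partial derivative of the amplitude in place of the
  amplitude and a scalar weight in place of the matrix.\<close>

lemma inner_reg_flux:
  assumes "x \<in> \<Omega>"
  shows "((\<lambda>t. 2 * (wR t x * (harmonic \<omega> t (partial_deriv j a x) \<bullet> harmonic \<omega> t c))) has_integral (c \<bullet> R j x)) {0..T}"
proof -
  let ?F = "\<lambda>t. exp (- (\<i> * complex_of_real (t * \<omega>)))"
  let ?d = "partial_deriv j a x"
  have cw: "continuous_on {0..T} (\<lambda>t. wR t x)"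
    by (rule continuous_on_slice[OF continuous_on_weights(2) assms])
  have "((\<lambda>t. 2 * complex_of_real (wR t x * harmonic \<omega> t ?d $ k) * ?F t) has_integral (R j x $ k)) {0..T}" for k
  proof -
    have "((\<lambda>t. (complex_of_real (wR t x) * exp (- (\<i> * complex_of_real (t * 0)))) * ?d $ k
        + (complex_of_real (wR t x) * exp (- (\<i> * complex_of_real (t * (2 * \<omega>))))) * cnj (?d $ k)) has_integral
       (fourier T wR 0 x * ?d $ k + fourier T wR (2 * \<omega>) x * cnj (?d $ k))) {0..T}"
      by (intro has_integral_add has_integral_mult_left fourier_has_integral cw)
    also have "fourier T wR 0 x * ?d $ k + fourier T wR (2 * \<omega>) x * cnj (?d $ k) = R j x $ k"
      by (simp add: reg_flux_def conj_vec_def)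
    finally show ?thesis
    proof (rule has_integral_eq[rotated])
      fix t
      have h: "Re (?d $ k * exp (\<i> * complex_of_real (\<omega> * t))) = harmonic \<omega> t ?d $ k"
        by (simp add: harmonic_def)
      have "(complex_of_real (wR t x) * exp (- (\<i> * complex_of_real (t * 0)))) * ?d $ k
        + (complex_of_real (wR t x) * exp (- (\<i> * complex_of_real (t * (2 * \<omega>))))) * cnj (?d $ k)
        = complex_of_real (wR t x) * (?d $ k + cnj (?d $ k) * exp (- (\<i> * complex_of_real (t * (2 * \<omega>)))))"
        by (simp add: algebra_simps)
      also have "\<dots> = 2 * complex_of_real (wR t x * harmonic \<omega> t ?d $ k) * ?F t"
        unfolding demodulation h by (simp add: mult_ac)
      finally show "(complex_of_real (wR t x) * exp (- (\<i> * complex_of_real (t * 0)))) * ?d $ k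
        + (complex_of_real (wR t x) * exp (- (\<i> * complex_of_real (t * (2 * \<omega>))))) * cnj (?d $ k)
        = 2 * complex_of_real (wR t x * harmonic \<omega> t ?d $ k) * ?F t" .
    qed
  qed
  then have int: "((\<lambda>t. \<Sum>k\<in>UNIV. c $ k \<bullet> (2 * complex_of_real (wR t x * harmonic \<omega> t ?d $ k) * ?F t)) has_integral
      (\<Sum>k\<in>UNIV. c $ k \<bullet> R j x $ k)) {0..T}"
    by (intro has_integral_sum has_integral_linear[OF _ bounded_linear_inner_right, unfolded o_def]) auto
  have "c $ k \<bullet> (2 * complex_of_real r * ?F t) = 2 * r * harmonic \<omega> t c $ k" for k r t
    using inner_demodulated[of "c $ k" "2 * r" t \<omega>] by (simp add: harmonic_def)
  from int[unfolded this] show ?thesis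
    by (simp add: inner_vec_def sum_distrib_left mult_ac)
qed

text \<open>Paired with a fixed vector, the data term is a time integral of a jointly continuous
  density over a compact interval.\<close>

lemma continuous_on_data_term: "continuous_on \<Omega> D"
proof (rule continuous_on_componentwise[THEN iffD2], rule ballI)
  fix c :: "complex^'n"
  show "continuous_on \<Omega> (\<lambda>x. D x \<bullet> c)"
    by (rule continuous_on_eq[OF continuous_on_integral_slice[OF continuous_on_data_density[of c]]])
      (subst inner_commute, erule integral_unique[OF inner_data_term])
qed

lemma continuous_on_reg_flux: "continuous_on \<Omega> (R j)"
proof (rule continuous_on_componentwise[THEN iffD2], rule ballI)
  fix c :: "complex^'n"
  show "continuous_on \<Omega> (\<lambda>x. R j x \<bullet> c)"
    by (rule continuous_on_eq[OF continuous_on_integral_slice[OF continuous_on_flux_density[of j c]]])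
      (subst inner_commute, erule integral_unique[OF inner_reg_flux])
qed

end

lemma
  fixes \<phi> :: "real^'n::finite \<Rightarrow> real"
  assumes \<phi>: "C1_on UNIV \<phi>"
  shows C1_on_has_frechet_derivative: "(\<phi> has_derivative frechet_derivative \<phi> (at x)) (at x)"
    and continuous_on_partial_deriv: "continuous_on B (partial_deriv j \<phi>)"
    and partial_deriv_zero_off_support:
      "compact K \<Longrightarrow> (\<And>x. x \<notin> K \<Longrightarrow> \<phi> x = 0) \<Longrightarrow> x \<notin> K \<Longrightarrow> partial_deriv j \<phi> x = 0"
proof -
  obtain \<phi>' where \<phi>': "\<forall>x. (\<phi> has_derivative \<phi>' x) (at x)" "\<forall>h. continuous_on UNIV (\<lambda>x. \<phi>' x h)"
    using C1_onD[OF \<phi>] by auto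
  have pd: "partial_deriv j \<phi> = (\<lambda>x. \<phi>' x (axis j 1))" for j
    by (rule ext, rule partial_deriv_eq[OF \<phi>'(1)[rule_format]])
  show "(\<phi> has_derivative frechet_derivative \<phi> (at x)) (at x)"
    using \<phi>'(1) frechet_derivative_at by metis
  show "continuous_on B (partial_deriv j \<phi>)"
    unfolding pd by (rule continuous_on_subset[OF \<phi>'(2)[rule_format] subset_UNIV])
  assume "compact K" "\<And>x. x \<notin> K \<Longrightarrow> \<phi> x = 0" "x \<notin> K"
  then show "partial_deriv j \<phi> x = 0"
    unfolding pd using has_derivative_zero_off_support[OF \<phi>'(1)[rule_format] compact_imp_closed] by simp
qed

section \<open>The energy density along a variation and the weak form\<close>

context flow_problem begin

definition energy_density :: "(real^'n \<Rightarrow> complex^'n) \<Rightarrow> real \<Rightarrow> real^'n \<Rightarrow> real" where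
  "energy_density b t x = q \<epsilon> (flow_residual T I (harmonic_flow \<omega> b) t x) (flow_residual T I u t x)
     + lam * q \<delta> (norm (jacobian (harmonic_flow \<omega> b t) (at x))) (norm (jacobian (u t) (at x)))"

lemma energy_eq: "energy T \<Omega> I lam \<epsilon> \<delta> u (harmonic_flow \<omega> b)
    = (\<integral>\<^sup>+x\<in>\<Omega>. (\<integral>\<^sup>+t\<in>{0..T}. ennreal (energy_density b t x) \<partial>lborel) \<partial>lborel)"
  by (simp add: energy_def energy_density_def)

lemma energy_density_nonneg: "0 \<le> energy_density b t x"
  using eps_pos lam_pos by (simp add: energy_density_def q_def max_def)

lemma continuous_on_jacobian_flow [continuous_intros]:
  "continuous_on S (\<lambda>z. jacobian (harmonic_flow \<omega> a (fst z)) (at (snd z)))"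
proof -
  have "continuous_on S (\<lambda>z. \<chi> k j. harmonic \<omega> (fst z) (partial_deriv j a (snd z)) $ k)"
    by (intro continuous_intros)
  then show ?thesis
    by (rule continuous_on_eq) (auto simp: jacobian_harmonic_flow[OF a_deriv])
qed

lemma continuous_on_energy_density: "continuous_on S (\<lambda>z. energy_density a (fst z) (snd z))"
proof -
  have "max \<epsilon> y \<noteq> 0" "max \<delta> y \<noteq> 0" for y
    using eps_pos by (auto simp: max_def)
  moreover have "continuous_on S (\<lambda>z. flow_residual T I u (fst z) (snd z))"
    unfolding flow_residual_def by (intro continuous_intros)
  ultimately show ?thesis
    unfolding energy_density_def q_def by (intro continuous_intros; simp)
qed

definition lin :: "(real^'n \<Rightarrow> real) \<Rightarrow> complex^'n \<Rightarrow> real \<Rightarrow> real^'n \<Rightarrow> real" where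
  "lin \<phi> c t x = \<phi> x * (wD t x * G t x * (grad (I t) x \<bullet> harmonic \<omega> t c))
     + lam * (\<Sum>j\<in>UNIV. partial_deriv j \<phi> x * (wR t x * (harmonic \<omega> t (partial_deriv j a x) \<bullet> harmonic \<omega> t c)))"

definition quadr :: "(real^'n \<Rightarrow> real) \<Rightarrow> complex^'n \<Rightarrow> real \<Rightarrow> real^'n \<Rightarrow> real" where
  "quadr \<phi> c t x = 1 / 2 * (wD t x * (\<phi> x * (grad (I t) x \<bullet> harmonic \<omega> t c))\<^sup>2
     + lam * wR t x * (\<Sum>j\<in>UNIV. (partial_deriv j \<phi> x)\<^sup>2 * (harmonic \<omega> t c \<bullet> harmonic \<omega> t c)))"

text \<open>There is no remainder: the weights and the additive maxima depend on \<open>u\<close>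
  and not on the varied flow, while the flow residual and the Jacobian are affine in
  \<open>s\<close>.\<close>

lemma energy_density_variation:
  assumes x: "x \<in> \<Omega>" and \<phi>: "(\<phi> has_derivative \<phi>') (at x)"
  shows "energy_density (\<lambda>x. a x + \<phi> x *\<^sub>R (s *\<^sub>R c)) t x = energy_density a t x + s * lin \<phi> c t x + s\<^sup>2 * quadr \<phi> c t x"
proof -
  let ?b = "\<lambda>x. a x + \<phi> x *\<^sub>R (s *\<^sub>R c)" and ?h = "\<lambda>x. \<phi> x *\<^sub>R c"
  let ?Ja = "jacobian (harmonic_flow \<omega> a t) (at x)" and ?Jh = "jacobian (harmonic_flow \<omega> ?h t) (at x)"
  let ?g = "grad (I t) x \<bullet> harmonic \<omega> t c"
  have h: "(?h has_derivative (\<lambda>h. \<phi>' h *\<^sub>R c)) (at x)"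
    by (rule has_derivative_scaleR_left[OF \<phi>])
  have b: "(?b has_derivative (\<lambda>h. A x h + \<phi>' h *\<^sub>R (s *\<^sub>R c))) (at x)"
    by (intro has_derivative_add a_deriv x has_derivative_scaleR_left \<phi>)
  have Jb: "jacobian (harmonic_flow \<omega> ?b t) (at x) = ?Ja + s *\<^sub>R ?Jh"
    unfolding jacobian_harmonic_flow[OF b] jacobian_harmonic_flow[OF a_deriv[OF x]] jacobian_harmonic_flow[OF h]
      partial_deriv_eq[OF b] partial_deriv_eq[OF a_deriv[OF x]] partial_deriv_eq[OF h]
    by (simp add: vec_eq_iff harmonic_add harmonic_scaleR)
  have ph: "partial_deriv j ?h x = partial_deriv j \<phi> x *\<^sub>R c" for j
    by (simp add: partial_deriv_eq[OF h] partial_deriv_eq[OF \<phi>])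
  have nb: "(norm (?Ja + s *\<^sub>R ?Jh))\<^sup>2 = (norm ?Ja)\<^sup>2 + 2 * s * (?Ja \<bullet> ?Jh) + s\<^sup>2 * (?Jh \<bullet> ?Jh)"
    unfolding power2_norm_eq_inner
    by (simp add: inner_add_left inner_add_right inner_commute[of ?Jh ?Ja] power2_eq_square[of s] algebra_simps)
  have ah: "?Ja \<bullet> ?Jh = (\<Sum>j\<in>UNIV. partial_deriv j \<phi> x * (harmonic \<omega> t (partial_deriv j a x) \<bullet> harmonic \<omega> t c))"
    by (simp add: inner_jacobian_harmonic_flow[OF a_deriv[OF x] h] ph harmonic_scaleR)
  have hh: "?Jh \<bullet> ?Jh = (\<Sum>j\<in>UNIV. (partial_deriv j \<phi> x)\<^sup>2 * (harmonic \<omega> t c \<bullet> harmonic \<omega> t c))"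
    by (simp add: inner_jacobian_harmonic_flow[OF h h] ph harmonic_scaleR power2_eq_square mult_ac)
  have Gb: "flow_residual T I (harmonic_flow \<omega> ?b) t x = G t x + s * (\<phi> x * ?g)"
    by (simp add: flow_residual_def harmonic_flow_eq harmonic_add harmonic_scaleR inner_add_right algebra_simps)
  have "energy_density ?b t x = 1 / 2 * wD t x * (G t x + s * (\<phi> x * ?g))\<^sup>2 + 1 / 2 * max \<epsilon> \<bar>flow_residual T I u t x\<bar>
    + lam * (1 / 2 * wR t x * (norm (?Ja + s *\<^sub>R ?Jh))\<^sup>2 + 1 / 2 * max \<delta> (norm (jacobian (u t) (at x))))"
    unfolding energy_density_def q_eq Gb Jb data_weight_def reg_weight_def by simp
  also have "\<dots> = 1 / 2 * wD t x * (G t x)\<^sup>2 + 1 / 2 * max \<epsilon> \<bar>flow_residual T I u t x\<bar>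
    + lam * (1 / 2 * wR t x * (norm ?Ja)\<^sup>2 + 1 / 2 * max \<delta> (norm (jacobian (u t) (at x))))
    + s * (\<phi> x * (wD t x * G t x * ?g) + lam * (wR t x * (?Ja \<bullet> ?Jh)))
    + s\<^sup>2 * (1 / 2 * (wD t x * (\<phi> x * ?g)\<^sup>2 + lam * wR t x * (?Jh \<bullet> ?Jh)))"
    unfolding nb by (simp add: power2_eq_square algebra_simps)
  also have "1 / 2 * wD t x * (G t x)\<^sup>2 + 1 / 2 * max \<epsilon> \<bar>flow_residual T I u t x\<bar>
    + lam * (1 / 2 * wR t x * (norm ?Ja)\<^sup>2 + 1 / 2 * max \<delta> (norm (jacobian (u t) (at x)))) = energy_density a t x"
    unfolding energy_density_def q_eq data_weight_def reg_weight_def by simp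
  also have "\<phi> x * (wD t x * G t x * ?g) + lam * (wR t x * (?Ja \<bullet> ?Jh)) = lin \<phi> c t x"
    unfolding lin_def ah by (simp add: sum_distrib_left mult_ac)
  also have "1 / 2 * (wD t x * (\<phi> x * ?g)\<^sup>2 + lam * wR t x * (?Jh \<bullet> ?Jh)) = quadr \<phi> c t x"
    unfolding quadr_def hh ..
  finally show ?thesis .
qed

text \<open>The factor one half undoes the 2 produced by \<open>demodulation\<close>. The constant
  \<open>lam\<close> is moved onto the flux, which is the field whose divergence is taken.\<close>

lemma lin_has_integral:
  assumes x: "x \<in> \<Omega>"
  shows "((\<lambda>t. lin \<phi> c t x) has_integral
      1 / 2 * (c \<bullet> (\<phi> x *\<^sub>R D x + (\<Sum>j\<in>UNIV. partial_deriv j \<phi> x *\<^sub>R (lam *\<^sub>R R j x))))) {0..T}"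
proof -
  have "((\<lambda>t. 1 / 2 * (\<phi> x * (2 * (wD t x * G t x * (grad (I t) x \<bullet> harmonic \<omega> t c)))
     + lam * (\<Sum>j\<in>UNIV. partial_deriv j \<phi> x * (2 * (wR t x * (harmonic \<omega> t (partial_deriv j a x) \<bullet> harmonic \<omega> t c))))))
    has_integral 1 / 2 * (\<phi> x * (c \<bullet> D x) + lam * (\<Sum>j\<in>UNIV. partial_deriv j \<phi> x * (c \<bullet> R j x)))) {0..T}"
    by (intro has_integral_mult_right has_integral_add has_integral_sum inner_data_term inner_reg_flux x) auto
  moreover have "1 / 2 * (\<phi> x * (2 * (wD t x * G t x * (grad (I t) x \<bullet> harmonic \<omega> t c)))
     + lam * (\<Sum>j\<in>UNIV. partial_deriv j \<phi> x * (2 * (wR t x * (harmonic \<omega> t (partial_deriv j a x) \<bullet> harmonic \<omega> t c)))))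
     = lin \<phi> c t x" for t
    by (simp add: lin_def sum_distrib_left algebra_simps)
  moreover have "1 / 2 * (\<phi> x * (c \<bullet> D x) + lam * (\<Sum>j\<in>UNIV. partial_deriv j \<phi> x * (c \<bullet> R j x)))
    = 1 / 2 * (c \<bullet> (\<phi> x *\<^sub>R D x + (\<Sum>j\<in>UNIV. partial_deriv j \<phi> x *\<^sub>R (lam *\<^sub>R R j x))))"
    by (simp add: inner_add_right inner_sum_right sum_distrib_left mult_ac)
  ultimately show "((\<lambda>t. lin \<phi> c t x) has_integral
      1 / 2 * (c \<bullet> (\<phi> x *\<^sub>R D x + (\<Sum>j\<in>UNIV. partial_deriv j \<phi> x *\<^sub>R (lam *\<^sub>R R j x))))) {0..T}"
    by (simp only:)
qed

text \<open>The integral is taken over \<open>K\<close>, where every integrand is continuous and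
  hence integrable; over all of \<open>\<Omega>\<close> the separate coefficients of
  \<open>s\<close> are compared only after the part off \<open>K\<close> is gone.\<close>

lemma weak_form:
  assumes \<phi>: "C2_on UNIV \<phi>" and K: "compact K" "K \<subseteq> \<Omega>" "\<And>x. x \<notin> K \<Longrightarrow> \<phi> x = 0"
    and v: "harmonic_flow \<omega> a \<in> harmonic_flows T \<Omega> \<omega>"
    and min: "\<And>b. harmonic_flow \<omega> b \<in> harmonic_flows T \<Omega> \<omega> \<Longrightarrow>
        energy T \<Omega> I lam \<epsilon> \<delta> u (harmonic_flow \<omega> a) \<le> energy T \<Omega> I lam \<epsilon> \<delta> u (harmonic_flow \<omega> b)"
    and fin: "energy T \<Omega> I lam \<epsilon> \<delta> u (harmonic_flow \<omega> a) < \<infinity>"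
  shows "(LINT x:K|lborel. c \<bullet> (\<phi> x *\<^sub>R D x + (\<Sum>j\<in>UNIV. partial_deriv j \<phi> x *\<^sub>R (lam *\<^sub>R R j x)))) = 0"
proof -
  note \<phi>1 = C2_onD[OF \<phi>]
  have c\<phi>: "continuous_on S (\<lambda>z. \<phi> (snd z))" "continuous_on S (\<lambda>z. partial_deriv j \<phi> (snd z))" for j
    by (rule continuous_on_snd_comp continuous_on_partial_deriv[OF \<phi>1]
        continuous_on_subset[OF C1_on_imp_continuous_on[OF \<phi>1] subset_UNIV])+
  have cl: "continuous_on S (\<lambda>z. lin \<phi> c (fst z) (snd z))"
    unfolding lin_def by (intro continuous_intros c\<phi>)
  have cq: "continuous_on S (\<lambda>z. quadr \<phi> c (fst z) (snd z))"
    unfolding quadr_def by (intro continuous_intros c\<phi>)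
  note cd = continuous_on_energy_density
  have off: "lin \<phi> c t x = 0" "quadr \<phi> c t x = 0" if "x \<notin> K" for t x
    using partial_deriv_zero_off_support[OF \<phi>1 K(1,3) that] K(3)[OF that]
    by (simp_all add: lin_def quadr_def)
  \<comment> \<open>Putting \<open>s\<close> into the constant vector keeps the perturbation of the
    form test function times vector, for which admissibility and the expansion are already
    known.\<close>
  define b where "b s = (\<lambda>x. a x + \<phi> x *\<^sub>R (s *\<^sub>R c))" for s
  let ?int = "\<lambda>f. LINT x:K|lborel. integral {0..T} (\<lambda>t. f t x)"
  have sint: "set_integrable lborel K (\<lambda>x. integral {0..T} (\<lambda>t. f t x))"
    if "continuous_on S (\<lambda>z. f (fst z) (snd z))" for f :: "real \<Rightarrow> real^'n \<Rightarrow> real"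
    unfolding set_integrable_def
    by (intro borel_integrable_compact K(1) continuous_on_subset[OF continuous_on_integral_slice[OF that] K(2)])
  have tint: "(\<lambda>t. f t x) integrable_on {0..T}"
    if "continuous_on S (\<lambda>z. f (fst z) (snd z))" "x \<in> \<Omega>" for f :: "real \<Rightarrow> real^'n \<Rightarrow> real" and x
    by (intro integrable_continuous_interval continuous_on_slice[OF that])
  have "0 \<le> s * ?int (lin \<phi> c) + s\<^sup>2 * ?int (quadr \<phi> c)" for s
  proof -
    have eq: "energy_density (b s) t x = energy_density a t x + s * lin \<phi> c t x + s\<^sup>2 * quadr \<phi> c t x" if "x \<in> \<Omega>" for t x
      unfolding b_def by (rule energy_density_variation[OF that C1_on_has_frechet_derivative[OF \<phi>1]])
    have "C2_on S (\<lambda>z. (case z of (t, x) \<Rightarrow> harmonic_flow \<omega> a t x)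
        + (case z of (t, x) \<Rightarrow> harmonic_flow \<omega> (\<lambda>x. \<phi> x *\<^sub>R (s *\<^sub>R c)) t x))"
      using v unfolding harmonic_flows_def
      by (intro C2_on_add C2_on_harmonic_flow_separated[OF \<phi>]) auto
    also have "(\<lambda>z. (case z of (t, x) \<Rightarrow> harmonic_flow \<omega> a t x)
        + (case z of (t, x) \<Rightarrow> harmonic_flow \<omega> (\<lambda>x. \<phi> x *\<^sub>R (s *\<^sub>R c)) t x))
        = (\<lambda>(t, x). harmonic_flow \<omega> (b s) t x)"
      unfolding b_def by (auto simp: harmonic_flow_eq harmonic_add)
    finally have "harmonic_flow \<omega> (b s) \<in> harmonic_flows T \<Omega> \<omega>"
      unfolding harmonic_flows_def by blast
    from min[OF this] have le: "(\<integral>\<^sup>+x\<in>\<Omega>. (\<integral>\<^sup>+t\<in>{0..T}. ennreal (energy_density a t x) \<partial>lborel) \<partial>lborel)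
        \<le> (\<integral>\<^sup>+x\<in>\<Omega>. (\<integral>\<^sup>+t\<in>{0..T}. ennreal (energy_density (b s) t x) \<partial>lborel) \<partial>lborel)"
      unfolding energy_eq .
    have cs: "continuous_on S (\<lambda>z. energy_density (b s) (fst z) (snd z))"
    proof (rule continuous_on_eq)
      show "continuous_on S (\<lambda>z. energy_density a (fst z) (snd z) + s * lin \<phi> c (fst z) (snd z) + s\<^sup>2 * quadr \<phi> c (fst z) (snd z))"
        by (intro continuous_intros cl cq cd)
    qed (auto simp: eq)
    \<comment> \<open>Both coefficients of the variation vanish off \<open>K\<close>, so there the
      two densities agree.\<close>
    have "?int (energy_density a) \<le> ?int (energy_density (b s))"
      by (rule nn_integral_mono_on_compact[OF open_dom K(1,2) cd cs _ _ _ le fin[unfolded energy_eq]])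
        (rule energy_density_nonneg, rule energy_density_nonneg, simp add: eq off)
    also have "?int (energy_density (b s)) = (LINT x:K|lborel. integral {0..T} (\<lambda>t. energy_density a t x)
        + s * integral {0..T} (\<lambda>t. lin \<phi> c t x) + s\<^sup>2 * integral {0..T} (\<lambda>t. quadr \<phi> c t x))"
    proof (intro set_lebesgue_integral_cong)
      show "K \<in> sets lborel" using K(1) by (simp add: borel_compact)
      show "\<forall>x. x \<in> K \<longrightarrow> integral {0..T} (\<lambda>t. energy_density (b s) t x) = integral {0..T} (\<lambda>t. energy_density a t x)
        + s * integral {0..T} (\<lambda>t. lin \<phi> c t x) + s\<^sup>2 * integral {0..T} (\<lambda>t. quadr \<phi> c t x)"
      proof (intro allI impI integral_unique)
        fix x assume "x \<in> K"
        then have x: "x \<in> \<Omega>" using K(2) by auto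
        show "((\<lambda>t. energy_density (b s) t x) has_integral integral {0..T} (\<lambda>t. energy_density a t x)
          + s * integral {0..T} (\<lambda>t. lin \<phi> c t x) + s\<^sup>2 * integral {0..T} (\<lambda>t. quadr \<phi> c t x)) {0..T}"
          unfolding eq[OF x]
          by (intro has_integral_add has_integral_mult_right integrable_integral tint cd cl cq x)
      qed
    qed
    also have "\<dots> = ?int (energy_density a) + s * ?int (lin \<phi> c) + s\<^sup>2 * ?int (quadr \<phi> c)"
      using sint[OF cd] sint[OF cl] sint[OF cq] by (simp add: set_integral_add)
    finally show ?thesis by simp
  qed
  then have "?int (lin \<phi> c) = 0"
    by (rule quadratic_nonneg_imp_linear_coeff_0)
  moreover have "?int (lin \<phi> c) = (LINT x:K|lborel. 1 / 2 * (c \<bullet> (\<phi> x *\<^sub>R D x + (\<Sum>j\<in>UNIV. partial_deriv j \<phi> x *\<^sub>R (lam *\<^sub>R R j x)))))"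
  proof (intro set_lebesgue_integral_cong allI impI integral_unique lin_has_integral)
    show "K \<in> sets lborel" using K(1) by (simp add: borel_compact)
  qed (use K(2) in auto)
  ultimately show ?thesis by simp
qed

lemma weak_divergence:
  assumes v: "harmonic_flow \<omega> a \<in> harmonic_flows T \<Omega> \<omega>"
    and min: "\<And>b. harmonic_flow \<omega> b \<in> harmonic_flows T \<Omega> \<omega> \<Longrightarrow>
        energy T \<Omega> I lam \<epsilon> \<delta> u (harmonic_flow \<omega> a) \<le> energy T \<Omega> I lam \<epsilon> \<delta> u (harmonic_flow \<omega> b)"
    and fin: "energy T \<Omega> I lam \<epsilon> \<delta> u (harmonic_flow \<omega> a) < \<infinity>"
  shows "has_weak_divergence_on (\<lambda>j x. lam *\<^sub>R R j x) D \<Omega>"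
  unfolding has_weak_divergence_on_def
proof (intro conjI allI impI; (elim conjE exE)?)
  have int: "set_integrable lborel K f" if "compact K" "K \<subseteq> \<Omega>" "continuous_on \<Omega> f"
    for K and f :: "real^'n \<Rightarrow> complex^'n"
    unfolding set_integrable_def
    by (intro borel_integrable_compact that(1) continuous_on_subset[OF that(3,2)])
  fix K :: "(real^'n) set" assume K: "compact K" "K \<subseteq> \<Omega>"
  show "set_integrable lborel K D"
    by (rule int[OF K continuous_on_data_term])
  show "set_integrable lborel K (\<lambda>x. lam *\<^sub>R R j x)" for j
    by (rule int[OF K]) (intro continuous_intros continuous_on_reg_flux)
next
  fix \<phi> :: "real^'n \<Rightarrow> real" and K
  assume \<phi>: "C2_on UNIV \<phi>" and K: "compact K" "K \<subseteq> \<Omega>" "\<forall>x. x \<notin> K \<longrightarrow> \<phi> x = 0"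
  note \<phi>1 = C2_onD[OF \<phi>]
  have c\<phi>: "continuous_on K \<phi>" "continuous_on K (partial_deriv j \<phi>)" for j
    by (rule continuous_on_partial_deriv[OF \<phi>1]
        continuous_on_subset[OF C1_on_imp_continuous_on[OF \<phi>1] subset_UNIV])+
  have off: "partial_deriv j \<phi> x = 0" "\<phi> x = 0" if "x \<notin> K" for x j
    using partial_deriv_zero_off_support[OF \<phi>1 K(1) _ that] K(3) that by blast+
  let ?g = "\<lambda>x. \<phi> x *\<^sub>R D x" and ?X = "\<lambda>x. \<Sum>j\<in>UNIV. partial_deriv j \<phi> x *\<^sub>R (lam *\<^sub>R R j x)"
  have cD: "continuous_on K D" "continuous_on K (R j)" for j
    by (rule continuous_on_subset[OF continuous_on_data_term K(2)] continuous_on_subset[OF continuous_on_reg_flux K(2)])+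
  have int: "set_integrable lborel K ?g" "set_integrable lborel K ?X"
    unfolding set_integrable_def by (intro borel_integrable_compact K(1) continuous_intros c\<phi> cD)+
  \<comment> \<open>The weak divergence integrates over \<open>\<Omega>\<close>, but the test
    function and its derivatives vanish off \<open>K\<close>.\<close>
  have restrict: "(LINT x:\<Omega>|lborel. f x) = (LINT x:K|lborel. f x)" if "\<And>x. x \<notin> K \<Longrightarrow> f x = 0" for f :: "real^'n \<Rightarrow> complex^'n"
    unfolding set_lebesgue_integral_def using K(2) that
    by (intro Bochner_Integration.integral_cong) (auto simp: indicator_def)
  have "c \<bullet> (LINT x:K|lborel. ?g x + ?X x) = 0" for c
  proof -
    have "c \<bullet> (LINT x:K|lborel. ?g x + ?X x) = (LINT x:K|lborel. c \<bullet> (?g x + ?X x))"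
      using set_integral_add(1)[OF int] unfolding set_integrable_def set_lebesgue_integral_def
      by (subst integral_inner_right[symmetric]) auto
    also have "\<dots> = 0"
      using K by (intro weak_form[OF \<phi> _ _ _ v min fin]) auto
    finally show ?thesis .
  qed
  \<comment> \<open>The vector \<open>c\<close> is chosen to be the integral itself, whose inner
    product with itself is then zero.\<close>
  then have "(LINT x:K|lborel. ?g x + ?X x) = 0"
    by (rule inner_eq_zero_iff[THEN iffD1])
  then have "(LINT x:K|lborel. ?g x) = - (LINT x:K|lborel. ?X x)"
    by (simp only: set_integral_add(2)[OF int] eq_neg_iff_add_eq_0)
  moreover have "(LINT x:\<Omega>|lborel. ?g x) = (LINT x:K|lborel. ?g x)" "(LINT x:\<Omega>|lborel. ?X x) = (LINT x:K|lborel. ?X x)"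
    by (rule restrict; simp add: off)+
  ultimately show "(LINT x:\<Omega>|lborel. ?g x) = - (LINT x:\<Omega>|lborel. ?X x)" by simp
qed

end

section \<open>The equation for the amplitude of the minimizer\<close>

lemma partial_deriv_scaleR:
  assumes "f differentiable (at x)"
  shows "partial_deriv j (\<lambda>x. r *\<^sub>R f x) x = r *\<^sub>R partial_deriv j f x"
proof -
  obtain f' where f': "(f has_derivative f') (at x)"
    using assms unfolding differentiable_def by blast
  show ?thesis
    by (simp add: partial_deriv_eq[OF has_derivative_scaleR_right[OF f']] partial_deriv_eq[OF f'])
qed

text \<open>The conclusion has two layers because the flux is known only to be continuous: the
  equation holds as a distributional divergence on \<open>\<Omega>\<close>, and literally at each
  point where all flux components are differentiable. Finite energy rules out the degenerate case in
  which every admissible flow has infinite energy and is therefore a minimizer.\<close>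

theorem theorem6:
  fixes \<Omega> :: "(real^'n::finite) set"
    and \<omega> T lam \<epsilon> \<delta> :: real
    and p :: nat
    and I :: "real \<Rightarrow> real^'n \<Rightarrow> real"
    and u v :: "real \<Rightarrow> real^'n \<Rightarrow> real^'n"
    and a :: "real^'n \<Rightarrow> complex^'n"
  assumes "open \<Omega>" and "connected \<Omega>" and "\<Omega> \<noteq> {}" and "bounded \<Omega>"
    and "T = 2 * pi * real p / \<omega>" and "T > 0"
    and "lam > 0" and "\<epsilon> > 0" and "\<delta> > 0"
    and "C1_on ({0..T} \<times> \<Omega>) (\<lambda>(t, x). I t x)"
    and "C1_on ({0..T} \<times> \<Omega>) (\<lambda>(t, x). u t x)"
    and "is_arg_min (energy T \<Omega> I lam \<epsilon> \<delta> u) (\<lambda>w. w \<in> harmonic_flows T \<Omega> \<omega>) v"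
    and "energy T \<Omega> I lam \<epsilon> \<delta> u v < \<infinity>"
    and "v = harmonic_flow \<omega> a"
  shows "has_weak_divergence_on (\<lambda>j x. lam *\<^sub>R reg_flux T \<omega> \<delta> u a j x) (data_term T \<omega> \<epsilon> I u a) \<Omega> \<and>
    (\<forall>x\<in>\<Omega>. (\<forall>j. reg_flux T \<omega> \<delta> u a j differentiable (at x)) \<longrightarrow>
       data_term T \<omega> \<epsilon> I u a x
         = lam *\<^sub>R (\<Sum>j\<in>UNIV. partial_deriv j (reg_flux T \<omega> \<delta> u a j) x))"
proof -
  have v: "v \<in> harmonic_flows T \<Omega> \<omega>"
    and le: "\<And>w. w \<in> harmonic_flows T \<Omega> \<omega> \<Longrightarrow>
      energy T \<Omega> I lam \<epsilon> \<delta> u v \<le> energy T \<Omega> I lam \<epsilon> \<delta> u w"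
    using assms(12) by (auto simp: is_arg_min_def not_less)
  have "C1_on ({0..T} \<times> \<Omega>) (\<lambda>(t, x). harmonic_flow \<omega> a t x)"
    using v assms(14) by (intro C2_onD) (simp add: harmonic_flows_def)
  from harmonic_amplitude_C1[OF this assms(1,5,6)] obtain A where A:
    "\<forall>x\<in>\<Omega>. (a has_derivative A x) (at x) \<and> (\<forall>h. continuous_on \<Omega> (\<lambda>x. A x h))" by blast
  interpret flow_problem \<Omega> \<omega> T lam \<epsilon> \<delta> I u a A
    using assms A by unfold_locales auto
  have weak: "has_weak_divergence_on (\<lambda>j x. lam *\<^sub>R reg_flux T \<omega> \<delta> u a j x) (data_term T \<omega> \<epsilon> I u a) \<Omega>"
    by (rule weak_divergence) (use v le assms(13,14) in auto)
  moreover have "data_term T \<omega> \<epsilon> I u a x = lam *\<^sub>R (\<Sum>j\<in>UNIV. partial_deriv j (reg_flux T \<omega> \<delta> u a j) x)"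
    if x: "x \<in> \<Omega>" and diff: "\<forall>j. reg_flux T \<omega> \<delta> u a j differentiable (at x)" for x
  proof -
    have "isCont (data_term T \<omega> \<epsilon> I u a) x"
      using continuous_on_data_term assms(1) x by (simp add: continuous_on_eq_continuous_at)
    from weak_divergence_at_differentiability_point[OF weak assms(1) x this] diff
    show ?thesis
      by (simp add: partial_deriv_scaleR scaleR_sum_right)
  qed
  ultimately show ?thesis by blast
qed

end
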